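(* Let $L\ge2$. The algebra $P_{0,L}$ is freely generated, as a graded commutative (unital) algebra, by the homogeneous elements $p(\widehat w)$ indexed by the circular words $\widehat w\in\widehat W_L$.
   Context: The ground field is $\mathbb C$; "graded commutative" means graded and commutative. $E_{ij\mid\alpha}$ denotes the matrix unit $E_{ij}$ in the $\alpha$-th copy of $\mathfrak{gl}(N,\mathbb C)$ in $\mathfrak{gl}(N,\mathbb C)^{\oplus L}$, $\alpha\in[L]=\{1,\dots,L\}$; $S(\cdot)$ is the symmetric algebra. For $0\le d\le N$, $\mathfrak{gl}_d(N,\mathbb C)$ is the span of $E_{ij}$ with $d<i,j\le N$; $\operatorname{diag}$ is the diagonal embedding into $\mathfrak{gl}(N,\mathbb C)^{\oplus L}$; $P_{d,L}(N):=S(\mathfrak{gl}(N,\mathbb C)^{\oplus L})^{\operatorname{diag}\mathfrak{gl}_d(N,\mathbb C)}$ (invariants of the adjoint action). Let $\mathcal I^+(N)$ be the ideal of $S(\mathfrak{gl}(N,\mathbb C)^{\oplus L})$ generated by all $E_{iN\mid\alpha}$, $1\le i\le N$, $\alpha\in[L]$. Then $P_{N-1,L}(N)=S(\mathfrak{gl}(N-1,\mathbb C)^{\oplus L})\oplus(P_{N-1,L}(N)\cap\mathcal I^+(N))$; the projection $\pi_{N,N-1}$ onto the first summand is a graded algebra morphism mapping $P_{d,L}(N)$ into $P_{d,L}(N-1)$ for $d\le N-1$. $P_{d,L}:=\varprojlim(P_{d,L}(N),\pi_{N,N-1})$ as $N\to\infty$, in the category of graded algebras (its $n$-th homogeneous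 component is the projective limit of the $n$-th homogeneous components). $W_L$ is the set of nonempty words in the alphabet $[L]$; $\widehat W_L$ is the set of circular words, i.e. equivalence classes of $W_L$ under cyclic permutations of letters. For $w=w_1\dots w_n\in W_L$ with class $\widehat w$, set $$p(\widehat w;N)=p(w;N):=\sum_{a_1,\dots,a_n=1}^N E_{a_1a_2\mid w_1}E_{a_2a_3\mid w_2}\cdots E_{a_na_1\mid w_n}\in P_{0,L}(N),$$ which depends only on $\widehat w$. These elements satisfy $\pi_{N,N-1}(p(\widehat w;N))=p(\widehat w;N-1)$ and so define a homogeneous element $p(\widehat w)\in P_{0,L}$ of degree $n$. *)

theory Defs
  imports Complex_Main "HOL-Library.Poly_Mapping" "HOL-Library.Function_Algebras"
begin

text \<open>
  Commutative polynomials with complex coefficients in variables of type \<open>'x\<close>: finitely supported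
  functions from monomials (finitely supported exponent functions) to coefficients, with the
  convolution product of \<open>HOL-Library.Poly_Mapping\<close>.
\<close>

type_synonym 'x mpol = "('x \<Rightarrow>\<^sub>0 nat) \<Rightarrow>\<^sub>0 complex"

definition Var :: "'x \<Rightarrow> 'x mpol" where
  "Var x = Poly_Mapping.single (Poly_Mapping.single x 1) 1"

definition Const :: "complex \<Rightarrow> 'x mpol" where
  "Const c = Poly_Mapping.single 0 c"

definition polys_in :: "'x set \<Rightarrow> 'x mpol set" where
  "polys_in X = {f. \<forall>m \<in> Poly_Mapping.keys f. Poly_Mapping.keys m \<subseteq> X}"

definition mon_degree :: "('x \<Rightarrow>\<^sub>0 nat) \<Rightarrow> nat" where
  "mon_degree m = (\<Sum>x \<in> Poly_Mapping.keys m. Poly_Mapping.lookup m x)"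

definition homogeneous :: "nat \<Rightarrow> 'x mpol \<Rightarrow> bool" where
  "homogeneous n f \<longleftrightarrow> (\<forall>m \<in> Poly_Mapping.keys f. mon_degree m = n)"

definition partial :: "'x \<Rightarrow> 'x mpol \<Rightarrow> 'x mpol" where
  "partial x f = (\<Sum>m \<in> Poly_Mapping.keys f.
     Poly_Mapping.single (m - Poly_Mapping.single x 1)
       (Poly_Mapping.lookup f m * of_nat (Poly_Mapping.lookup m x)))"

text \<open>
  Evaluation at a family \<open>g\<close> of elements of a commutative complex algebra whose structure map is
  \<open>\<iota>\<close> (that is, \<open>\<iota> c\<close> is \<open>c\<close> times the unit).
\<close>

definition poly_eval :: "(complex \<Rightarrow> 'a::comm_ring_1) \<Rightarrow> ('x \<Rightarrow> 'a) \<Rightarrow> 'x mpol \<Rightarrow> 'a" where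
  "poly_eval \<iota> g q = (\<Sum>m \<in> Poly_Mapping.keys q. \<iota> (Poly_Mapping.lookup q m) *
     (\<Prod>x \<in> Poly_Mapping.keys m. g x ^ Poly_Mapping.lookup m x))"

text \<open>
  For a graded algebra with homogeneous components \<open>G n\<close>, realised inside an ambient commutative
  algebra: the sum of the components, and the assertion that it is freely generated, as a unital
  commutative graded algebra, by the family \<open>g x\<close> (\<open>x \<in> X\<close>) with \<open>g x\<close> homogeneous of degree
  \<open>deg x\<close>, that is, that evaluation at \<open>g\<close> identifies the polynomial algebra on \<open>X\<close> with it.
\<close>

definition graded_sum :: "(nat \<Rightarrow> 'a::comm_ring_1 set) \<Rightarrow> 'a set" where
  "graded_sum G = {f. \<exists>D h. (\<forall>n\<le>D. h n \<in> G n) \<and> f = (\<Sum>n\<le>D. h n)}"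

definition freely_generated ::
    "(complex \<Rightarrow> 'a::comm_ring_1) \<Rightarrow> (nat \<Rightarrow> 'a set) \<Rightarrow> 'x set \<Rightarrow> ('x \<Rightarrow> nat) \<Rightarrow> ('x \<Rightarrow> 'a) \<Rightarrow> bool" where
  "freely_generated \<iota> G X deg g \<longleftrightarrow>
     (\<forall>x \<in> X. g x \<in> G (deg x)) \<and>
     bij_betw (poly_eval \<iota> g) (polys_in X) (graded_sum G)"


text \<open>
  The variable \<open>(i, j, \<alpha>)\<close> is the matrix unit \<open>E\<^sub>i\<^sub>j\<close> in the \<open>\<alpha>\<close>-th copy of \<open>gl(N)\<close>. The symmetric
  algebra of the direct sum of \<open>L\<close> copies of \<open>gl(N)\<close> is the polynomial algebra on this basis; for
  varying \<open>N\<close> these algebras are nested inside one polynomial ring.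
\<close>

type_synonym mvar = "nat \<times> nat \<times> nat"

definition basis :: "nat \<Rightarrow> nat \<Rightarrow> mvar set" where
  "basis L N = {1..N} \<times> {1..N} \<times> {1..L}"

definition Sym :: "nat \<Rightarrow> nat \<Rightarrow> mvar mpol set" where
  "Sym L N = polys_in (basis L N)"

text \<open>Elements of the direct sum: \<open>A \<alpha> i j\<close> is the \<open>(i, j)\<close> entry of the \<open>\<alpha>\<close>-th component.\<close>

type_synonym mats = "nat \<Rightarrow> nat \<Rightarrow> nat \<Rightarrow> complex"

fun unit_mat :: "mvar \<Rightarrow> mats" where
  "unit_mat (i, j, \<alpha>) = (\<lambda>\<beta> k l. if \<beta> = \<alpha> \<and> k = i \<and> l = j then 1 else 0)"

definition lie_bracket :: "nat \<Rightarrow> mats \<Rightarrow> mats \<Rightarrow> mats" where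
  "lie_bracket N A B =
     (\<lambda>\<alpha> i j. \<Sum>k = 1..N. A \<alpha> i k * B \<alpha> k j - B \<alpha> i k * A \<alpha> k j)"

definition linear_form :: "nat \<Rightarrow> nat \<Rightarrow> mats \<Rightarrow> mvar mpol" where
  "linear_form L N A = (\<Sum>(i, j, \<alpha>) \<in> basis L N. Const (A \<alpha> i j) * Var (i, j, \<alpha>))"

text \<open>The adjoint action of \<open>A\<close> on the symmetric algebra: the derivation extending the bracket.\<close>

definition ad :: "nat \<Rightarrow> nat \<Rightarrow> mats \<Rightarrow> mvar mpol \<Rightarrow> mvar mpol" where
  "ad L N A f = (\<Sum>v \<in> basis L N.
     partial v f * linear_form L N (lie_bracket N A (unit_mat v)))"

definition gl :: "nat \<Rightarrow> nat \<Rightarrow> (nat \<Rightarrow> nat \<Rightarrow> complex) set" where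
  "gl d N = {X. \<forall>i j. X i j \<noteq> 0 \<longrightarrow> i \<in> {d<..N} \<and> j \<in> {d<..N}}"

definition diag :: "(nat \<Rightarrow> nat \<Rightarrow> complex) \<Rightarrow> mats" where
  "diag X = (\<lambda>\<alpha>. X)"

definition P_fin :: "nat \<Rightarrow> nat \<Rightarrow> nat \<Rightarrow> mvar mpol set" where
  "P_fin d L N = {f \<in> Sym L N. \<forall>X \<in> gl d N. ad L N (diag X) f = 0}"

text \<open>The ideal of \<open>Sym L N\<close> generated by the elements of the last column.\<close>

definition I_plus :: "nat \<Rightarrow> nat \<Rightarrow> mvar mpol set" where
  "I_plus L N = {f. \<exists>h. (\<forall>i \<alpha>. h i \<alpha> \<in> Sym L N) \<and>
     f = (\<Sum>i = 1..N. \<Sum>\<alpha> = 1..L. h i \<alpha> * Var (i, N, \<alpha>))}"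

text \<open>
  The projection \<open>\<pi>\<^bsub>N,N-1\<^esub>\<close>, for \<open>N \<ge> 1\<close> and \<open>f \<in> P_fin (N - 1) L N\<close>, along the decomposition of
  \<open>P_fin (N - 1) L N\<close> as the direct sum of \<open>Sym L (N - 1)\<close> and
  \<open>P_fin (N - 1) L N \<inter> I_plus L N\<close>.
\<close>

definition proj :: "nat \<Rightarrow> nat \<Rightarrow> mvar mpol \<Rightarrow> mvar mpol" where
  "proj L N f =
     (THE g. g \<in> Sym L (N - 1) \<and> f - g \<in> P_fin (N - 1) L N \<inter> I_plus L N)"

text \<open>
  The homogeneous components of the projective limit of the algebras \<open>P_fin 0 L N\<close>, as compatible
  sequences indexed by \<open>N\<close>; the algebra operations on sequences are pointwise
  (\<open>HOL-Library.Function_Algebras\<close>). The limit in the category of graded algebras is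
  \<open>graded_sum (P_lim L)\<close>. Starting the sequences at \<open>N = 0\<close>, where \<open>P_fin 0 L 0\<close> consists of the
  constants, does not affect the limit.
\<close>

definition P_lim :: "nat \<Rightarrow> nat \<Rightarrow> (nat \<Rightarrow> mvar mpol) set" where
  "P_lim L n = {f. (\<forall>N. f N \<in> P_fin 0 L N \<and> homogeneous n (f N)) \<and>
     (\<forall>N. proj L (Suc N) (f (Suc N)) = f N)}"

definition seq_const :: "complex \<Rightarrow> nat \<Rightarrow> mvar mpol" where
  "seq_const c = (\<lambda>N. Const c)"


definition words :: "nat \<Rightarrow> nat list set" where
  "words L = {w. w \<noteq> [] \<and> set w \<subseteq> {1..L}}"

definition cyc_rel :: "nat \<Rightarrow> (nat list \<times> nat list) set" where
  "cyc_rel L = {(u, v). u \<in> words L \<and> v \<in> words L \<and> (\<exists>k. v = rotate k u)}"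

definition circular_words :: "nat \<Rightarrow> nat list set set" where
  "circular_words L = words L // cyc_rel L"

definition p_word :: "nat list \<Rightarrow> nat \<Rightarrow> mvar mpol" where
  "p_word w N = (\<Sum>a \<in> {a. length a = length w \<and> set a \<subseteq> {1..N}}.
     \<Prod>k < length w. Var (a ! k, a ! (Suc k mod length w), w ! k))"

text \<open>
  The length and the element \<open>p\<close> of a circular word: the common value on its representatives.
\<close>

definition circ_length :: "nat list set \<Rightarrow> nat" where
  "circ_length c = the_elem (length ` c)"

definition p_circ :: "nat list set \<Rightarrow> nat \<Rightarrow> mvar mpol" where
  "p_circ c = the_elem (p_word ` c)"

lemma p_word_rotate1: "p_word (rotate1 w) N = p_word w N"
proof (cases "w = []")
  case False
  define n where "n = length w"
  have n: "n > 0" using False by (simp add: n_def)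
  let ?A = "{a. length a = n \<and> set a \<subseteq> {1..N}}"
  let ?P = "\<lambda>v a. \<Prod>k<n. Var (a ! k, a ! (Suc k mod n), v ! k)"
  have inj: "inj_on rotate1 ?A"
    by (rule inj_on_subset[OF inj_rotate1]) simp
  have fin: "finite ?A"
    by (rule finite_subset[OF _ finite_lists_length_eq[of "{1..N}" n]]) auto
  have "rotate1 ` ?A \<subseteq> ?A" by auto
  then have im: "rotate1 ` ?A = ?A" using endo_inj_surj[OF fin _ inj] by blast
  have step: "?P (rotate1 w) (rotate1 a) = ?P w a" if "a \<in> ?A" for a
  proof -
    have la: "length a = n" using that by simp
    have bij: "bij_betw (\<lambda>k. Suc k mod n) {..<n} {..<n}"
    proof -
      have "inj_on (\<lambda>k. Suc k mod n) {..<n}"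
        by (auto simp: inj_on_def mod_Suc split: if_splits)
      moreover have "(\<lambda>k. Suc k mod n) ` {..<n} \<subseteq> {..<n}" using n by auto
      ultimately show ?thesis
        by (simp add: bij_betw_def endo_inj_surj)
    qed
    have "?P (rotate1 w) (rotate1 a)
        = (\<Prod>k<n. Var (a ! (Suc k mod n), a ! (Suc (Suc k mod n) mod n), w ! (Suc k mod n)))"
      using n la by (intro prod.cong) (auto simp: nth_rotate1 n_def)
    also have "\<dots> = ?P w a"
      using prod.reindex_bij_betw[OF bij, of "\<lambda>k. Var (a ! k, a ! (Suc k mod n), w ! k)"] by simp
    finally show ?thesis .
  qed
  have "p_word (rotate1 w) N = (\<Sum>a \<in> rotate1 ` ?A. ?P (rotate1 w) a)"
    unfolding im by (simp add: p_word_def n_def)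
  also have "\<dots> = (\<Sum>a \<in> ?A. ?P (rotate1 w) (rotate1 a))"
    by (subst sum.reindex[OF inj]) (simp only: o_def)
  also have "\<dots> = p_word w N"
    using step by (simp add: p_word_def n_def)
  finally show ?thesis .
qed simp

lemma circ_class:
  assumes "w \<in> words L"
  shows "p_circ (cyc_rel L `` {w}) = p_word w" "circ_length (cyc_rel L `` {w}) = length w"
proof -
  have rot: "p_word (rotate k w) = p_word w" for k
    by (induction k) (simp_all add: fun_eq_iff p_word_rotate1)
  have "w \<in> cyc_rel L `` {w}"
    using assms by (auto simp: cyc_rel_def intro: exI[where x = 0])
  then have "p_word ` (cyc_rel L `` {w}) = {p_word w}" "length ` (cyc_rel L `` {w}) = {length w}"
    using rot by (auto simp: cyc_rel_def image_iff)
  then show "p_circ (cyc_rel L `` {w}) = p_word w" "circ_length (cyc_rel L `` {w}) = length w"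
    by (simp_all add: p_circ_def circ_length_def)
qed

end

theory Submission
  imports Defs "HOL-Combinatorics.Cycles"
begin

text \<open>
  A monomial in the variables \<open>(i, j, \<alpha>)\<close> is a finite directed multigraph on the vertices \<open>1, \<dots>, N\<close>
  whose edges \<open>i \<rightarrow> j\<close> carry letters \<open>\<alpha>\<close>. The element \<open>p_word w N\<close> is the sum over all closed walks
  labelled by \<open>w\<close>, and a product of such elements is the sum over all placements, on the vertices, of
  the corresponding disjoint union of labelled cycles. A placement is most informative when it is
  injective: the monomial is then a disjoint union of cycles on distinct vertices, from which the
  multiset of circular words, its type, can be read off again (\<open>cycles_mon_determines_type\<close>). Hence a
  monomial \<open>M\<close> in the \<open>p_circ c\<close>, expanded at level \<open>N\<close>, has a nonzero coefficient at an injectively placed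
  graph of type \<open>M'\<close> exactly if \<open>M = M'\<close> (\<open>lookup_mono_eval_canonical_mon\<close>). This gives algebraic independence, because every
  type has an injective placement as soon as \<open>N\<close> is at least its number of edges.

  For generation, the first fundamental theorem of invariant theory can be bypassed, since in the limit
  only \<open>N\<close> that are large compared with the degree matter. Invariance under the diagonal matrices says that
  every vertex of a monomial occurring in an invariant has equal in- and out-degree. Invariance under
  \<open>E\<^sub>j\<^sub>i\<close> for a vertex \<open>j\<close> that does not occur allows one to split off \<open>j\<close> from a vertex \<open>i\<close>: it expresses
  the coefficient of a monomial in which \<open>i\<close> has out-degree at least two by coefficients of monomials with
  one more vertex, and it shows that \<open>i\<close> may be renamed to \<open>j\<close> in graphs with all out-degrees at most one
  (\<open>replace_row_identity\<close>). Consequently an invariant of degree \<open>n \<le> N\<close> is determined by its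
  coefficients at balanced graphs with all out-degrees at most one
  (\<open>invariant_eq_0_if_no_simple_monomial\<close>), these graphs are disjoint unions of cycles
  (\<open>simple_balanced_is_cycles_mon\<close>), and for \<open>3 n \<le> N\<close> the coefficient depends only on the type and not
  on the vertices used (\<open>coefficient_independent_of_indices\<close>).

  On invariants the projection simply deletes all monomials involving the vertex \<open>N\<close>
  (\<open>proj_eq_restrict_basis\<close>), so that coefficients are compatible along the projective system. Given a
  homogeneous element \<open>f\<close> of degree \<open>n\<close> of the limit, dividing its coefficients at one injective placement
  of every type by those of the corresponding product of \<open>p_circ c\<close> yields a polynomial \<open>q\<close>. The
  difference between \<open>f\<close> and the value of \<open>q\<close> has coefficient zero at all these placements, hence
  vanishes for all large \<open>N\<close>, and then for all \<open>N\<close> by projection.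
\<close>

section \<open>Coefficients of the adjoint action\<close>

abbreviation lk :: "('a \<Rightarrow>\<^sub>0 'b::zero) \<Rightarrow> 'a \<Rightarrow> 'b" where
  "lk \<equiv> Poly_Mapping.lookup"

abbreviation supp :: "('a \<Rightarrow>\<^sub>0 'b::zero) \<Rightarrow> 'a set" where
  "supp \<equiv> Poly_Mapping.keys"

text \<open>
  The exponent of a single variable. A separate constant keeps the simplifier from rewriting the exponent \<open>1\<close> to \<open>Suc 0\<close>.
\<close>

definition xvar :: "'x \<Rightarrow> ('x \<Rightarrow>\<^sub>0 nat)" where
  "xvar x = Poly_Mapping.single x 1"

lemma lookup_xvar: "lk (xvar x) y = (if x = y then 1 else 0)"
  by (simp add: xvar_def lookup_single when_def)

lemma supp_xvar [simp]: "supp (xvar x) = {x}"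
  by (simp add: xvar_def)

lemma Var_single: "Var x = Poly_Mapping.single (xvar x) 1"
  by (simp add: Var_def xvar_def)

lemma minus_xvar_eq_iff:
  assumes "lk m v > 0"
  shows "m - xvar v = k \<longleftrightarrow> m = k + xvar v"
proof -
  have "m - xvar v + xvar v = m"
    using assms by (intro poly_mapping_eqI) (auto simp: lookup_add lookup_minus lookup_xvar)
  then show ?thesis by auto
qed

lemma sum_single_lookup: "(\<Sum>m \<in> supp f. Poly_Mapping.single m (lk f m)) = f"
proof (rule poly_mapping_eqI)
  fix k show "lk (\<Sum>m \<in> supp f. Poly_Mapping.single m (lk f m)) k = lk f k"
    by (cases "k \<in> supp f") (auto simp: lookup_sum lookup_single when_def sum.delta' in_keys_iff)
qed

lemma lookup_partial:
  "lk (partial v f) m = of_nat (lk m v + 1) * lk f (m + xvar v)"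
proof -
  have "lk (partial v f) m =
      (\<Sum>m'\<in>supp f. lk f m' * of_nat (lk m' v) when m' - xvar v = m)"
    by (simp add: partial_def lookup_sum lookup_single xvar_def)
  also have "\<dots> = (\<Sum>m'\<in>supp f. if m' = m + xvar v then lk f m' * of_nat (lk m' v) else 0)"
  proof (rule sum.cong[OF refl])
    fix m' assume "m' \<in> supp f"
    show "(lk f m' * of_nat (lk m' v) when m' - xvar v = m) =
      (if m' = m + xvar v then lk f m' * of_nat (lk m' v) else 0)"
    proof (cases "lk m' v > 0")
      case True then show ?thesis by (simp add: minus_xvar_eq_iff when_def)
    next
      case False then show ?thesis by (auto simp: when_def)
    qed
  qed
  also have "\<dots> = of_nat (lk m v + 1) * lk f (m + xvar v)"
    by (auto simp: sum.delta in_keys_iff lookup_add lookup_xvar mult.commute)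
  finally show ?thesis .
qed

lemma lookup_times_Var:
  "lk (f * Var u) m = (if lk m u > 0 then lk f (m - xvar u) else 0)"
proof -
  have "f * Var u = (\<Sum>m' \<in> supp f. Poly_Mapping.single (m' + xvar u) (lk f m'))"
    by (subst sum_single_lookup[of f, symmetric])
      (simp add: sum_distrib_right Var_single mult_single)
  then have *: "lk (f * Var u) m = (\<Sum>m'\<in>supp f. if m' + xvar u = m then lk f m' else 0)"
    by (simp add: lookup_sum lookup_single when_def)
  show ?thesis
  proof (cases "lk m u > 0")
    case True
    then have "(m' + xvar u = m) = (m' = m - xvar u)" for m'
      using minus_xvar_eq_iff[OF True, of m'] by auto
    then show ?thesis using True by (auto simp: * sum.delta in_keys_iff)
  next
    case False
    then have "m' + xvar u \<noteq> m" for m' by (auto simp: lookup_add lookup_xvar)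
    then show ?thesis using False by (simp add: *)
  qed
qed

lemma Const_0 [simp]: "Const 0 = 0" and Const_1 [simp]: "Const 1 = 1"
  by (simp_all add: Const_def)

lemma Const_diff: "Const (a - b) = Const a - Const b"
  by (simp add: Const_def single_diff)

lemma finite_basis [simp]: "finite (basis L N)"
  by (simp add: basis_def)

text \<open>
  On a matrix unit the action is \<open>[X, E\<^sub>i\<^sub>j] = \<Sum>\<^sub>s X\<^sub>s\<^sub>i E\<^sub>s\<^sub>j - \<Sum>\<^sub>s X\<^sub>j\<^sub>s E\<^sub>i\<^sub>s\<close>, in every copy simultaneously.
\<close>

lemma ad_diag:
  "ad L N (diag X) f = (\<Sum>(i, j, \<alpha>) \<in> basis L N. partial (i, j, \<alpha>) f *
     ((\<Sum>s=1..N. Const (X s i) * Var (s, j, \<alpha>)) - (\<Sum>s=1..N. Const (X j s) * Var (i, s, \<alpha>))))"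
proof -
  have "linear_form L N (lie_bracket N (diag X) (unit_mat (i, j, \<alpha>))) =
     (\<Sum>s=1..N. Const (X s i) * Var (s, j, \<alpha>)) - (\<Sum>s=1..N. Const (X j s) * Var (i, s, \<alpha>))"
    if "(i, j, \<alpha>) \<in> basis L N" for i j \<alpha>
  proof -
    have i: "i \<in> {1..N}" and j: "j \<in> {1..N}" and \<alpha>: "\<alpha> \<in> {1..L}"
      using that by (auto simp: basis_def)
    have br: "lie_bracket N (diag X) (unit_mat (i, j, \<alpha>)) \<beta> k l =
       (if \<beta> = \<alpha> \<and> l = j then X k i else 0) - (if \<beta> = \<alpha> \<and> k = i then X j l else 0)" for \<beta> k l
    proof -
      have "(\<Sum>s=1..N. X k s * (if \<beta> = \<alpha> \<and> s = i \<and> l = j then 1 else 0)) =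
          (\<Sum>s=1..N. if s = i then (if \<beta> = \<alpha> \<and> l = j then X k i else 0) else 0)"
        by (rule sum.cong) auto
      moreover have "(\<Sum>s=1..N. (if \<beta> = \<alpha> \<and> k = i \<and> s = j then 1 else 0) * X s l) =
          (\<Sum>s=1..N. if s = j then (if \<beta> = \<alpha> \<and> k = i then X j l else 0) else 0)"
        by (rule sum.cong) auto
      ultimately show ?thesis using i j
        by (simp add: lie_bracket_def diag_def sum_subtractf sum.delta)
    qed
    have 1: "(\<Sum>(k, l, \<beta>) \<in> basis L N. Const (if \<beta> = \<alpha> \<and> l = j then X k i else 0) * Var (k, l, \<beta>))
       = (\<Sum>s=1..N. Const (X s i) * Var (s, j, \<alpha>))"
    proof -
      have "(\<Sum>s=1..N. Const (X s i) * Var (s, j, \<alpha>)) =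
         (\<Sum>(k, l, \<beta>) \<in> (\<lambda>s. (s, j, \<alpha>)) ` {1..N}. Const (X k i) * Var (k, l, \<beta>))"
        by (subst sum.reindex) (auto simp: inj_on_def)
      also have "\<dots> = (\<Sum>(k, l, \<beta>) \<in> basis L N. Const (if \<beta> = \<alpha> \<and> l = j then X k i else 0) * Var (k, l, \<beta>))"
        using j \<alpha> by (intro sum.mono_neutral_cong_left) (auto simp: basis_def)
      finally show ?thesis by simp
    qed
    have 2: "(\<Sum>(k, l, \<beta>) \<in> basis L N. Const (if \<beta> = \<alpha> \<and> k = i then X j l else 0) * Var (k, l, \<beta>))
       = (\<Sum>s=1..N. Const (X j s) * Var (i, s, \<alpha>))"
    proof -
      have "(\<Sum>s=1..N. Const (X j s) * Var (i, s, \<alpha>)) =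
         (\<Sum>(k, l, \<beta>) \<in> (\<lambda>s. (i, s, \<alpha>)) ` {1..N}. Const (X j l) * Var (k, l, \<beta>))"
        by (subst sum.reindex) (auto simp: inj_on_def)
      also have "\<dots> = (\<Sum>(k, l, \<beta>) \<in> basis L N. Const (if \<beta> = \<alpha> \<and> k = i then X j l else 0) * Var (k, l, \<beta>))"
        using i \<alpha> by (intro sum.mono_neutral_cong_left) (auto simp: basis_def)
      finally show ?thesis by simp
    qed
    show ?thesis
      unfolding linear_form_def br 1[symmetric] 2[symmetric]
      by (simp add: Const_diff left_diff_distrib sum_subtractf case_prod_unfold)
  qed
  then show ?thesis unfolding ad_def by (intro sum.cong) auto
qed

definition matrix_unit :: "nat \<Rightarrow> nat \<Rightarrow> nat \<Rightarrow> nat \<Rightarrow> complex" where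
  "matrix_unit j i = (\<lambda>s t. if s = j \<and> t = i then 1 else 0)"

lemma ad_matrix_unit:
  assumes "i \<in> {1..N}" "j \<in> {1..N}"
  shows "ad L N (diag (matrix_unit j i)) f =
     (\<Sum>(b, \<beta>) \<in> {1..N} \<times> {1..L}. partial (i, b, \<beta>) f * Var (j, b, \<beta>)) -
     (\<Sum>(a, \<beta>) \<in> {1..N} \<times> {1..L}. partial (a, j, \<beta>) f * Var (a, i, \<beta>))"
proof -
  have 1: "(\<Sum>s=1..N. Const (matrix_unit j i s k) * Var (s, l, \<beta>)) =
      (if k = i then Var (j, l, \<beta>) else 0)" for k l \<beta>
  proof -
    have "(\<Sum>s=1..N. Const (matrix_unit j i s k) * Var (s, l, \<beta>)) =
        (\<Sum>s=1..N. if s = j then (if k = i then Var (j, l, \<beta>) else 0) else 0)"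
      by (rule sum.cong) (auto simp: matrix_unit_def)
    then show ?thesis using assms by (simp add: sum.delta)
  qed
  have 2: "(\<Sum>s=1..N. Const (matrix_unit j i l s) * Var (k, s, \<beta>)) =
      (if l = j then Var (k, i, \<beta>) else 0)" for k l \<beta>
  proof -
    have "(\<Sum>s=1..N. Const (matrix_unit j i l s) * Var (k, s, \<beta>)) =
        (\<Sum>s=1..N. if s = i then (if l = j then Var (k, i, \<beta>) else 0) else 0)"
      by (rule sum.cong) (auto simp: matrix_unit_def)
    then show ?thesis using assms by (simp add: sum.delta)
  qed
  have 3: "(\<Sum>(k, l, \<beta>)\<in>basis L N. partial (k, l, \<beta>) f * (if k = i then Var (j, l, \<beta>) else 0)) =
    (\<Sum>(b, \<beta>) \<in> {1..N} \<times> {1..L}. partial (i, b, \<beta>) f * Var (j, b, \<beta>))"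
  proof -
    have "(\<Sum>(b, \<beta>) \<in> {1..N} \<times> {1..L}. partial (i, b, \<beta>) f * Var (j, b, \<beta>)) =
      (\<Sum>(k, l, \<beta>)\<in>(\<lambda>(b, \<beta>). (i, b, \<beta>)) ` ({1..N} \<times> {1..L}). partial (k, l, \<beta>) f * Var (j, l, \<beta>))"
      by (subst sum.reindex) (auto simp: inj_on_def case_prod_unfold)
    also have "\<dots> = (\<Sum>(k, l, \<beta>)\<in>basis L N. partial (k, l, \<beta>) f * (if k = i then Var (j, l, \<beta>) else 0))"
      using assms by (intro sum.mono_neutral_cong_left) (auto simp: basis_def image_iff)
    finally show ?thesis by simp
  qed
  have 4: "(\<Sum>(k, l, \<beta>)\<in>basis L N. partial (k, l, \<beta>) f * (if l = j then Var (k, i, \<beta>) else 0)) =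
    (\<Sum>(a, \<beta>) \<in> {1..N} \<times> {1..L}. partial (a, j, \<beta>) f * Var (a, i, \<beta>))"
  proof -
    have "(\<Sum>(a, \<beta>) \<in> {1..N} \<times> {1..L}. partial (a, j, \<beta>) f * Var (a, i, \<beta>)) =
      (\<Sum>(k, l, \<beta>)\<in>(\<lambda>(a, \<beta>). (a, j, \<beta>)) ` ({1..N} \<times> {1..L}). partial (k, l, \<beta>) f * Var (k, i, \<beta>))"
      by (subst sum.reindex) (auto simp: inj_on_def case_prod_unfold)
    also have "\<dots> = (\<Sum>(k, l, \<beta>)\<in>basis L N. partial (k, l, \<beta>) f * (if l = j then Var (k, i, \<beta>) else 0))"
      using assms by (intro sum.mono_neutral_cong_left) (auto simp: basis_def image_iff)
    finally show ?thesis by simp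
  qed
  show ?thesis unfolding ad_diag 1 2 3[symmetric] 4[symmetric]
    by (simp add: right_diff_distrib sum_subtractf case_prod_unfold)
qed

text \<open>
  The coefficient of \<open>m\<close> in the result of applying \<open>E\<^sub>j\<^sub>i\<close> to \<open>f\<close>. That operator replaces a row index \<open>i\<close> by \<open>j\<close> and,
  with a minus sign, a column index \<open>j\<close> by \<open>i\<close>; so the left-hand side runs over the ways of undoing a
  row replacement in \<open>m\<close>, and the right-hand side over those of undoing a column replacement. The factors
  are the exponents produced by differentiation.
\<close>

lemma invariant_coefficient_identity:
  assumes f: "f \<in> P_fin 0 L N" and ij: "i \<in> {1..N}" "j \<in> {1..N}"
  shows "(\<Sum>(b, \<beta>) \<in> {1..N} \<times> {1..L}. if lk m (j, b, \<beta>) > 0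
       then of_nat (lk (m - xvar (j, b, \<beta>)) (i, b, \<beta>) + 1) * lk f (m - xvar (j, b, \<beta>) + xvar (i, b, \<beta>))
       else 0) =
     (\<Sum>(a, \<beta>) \<in> {1..N} \<times> {1..L}. if lk m (a, i, \<beta>) > 0
       then of_nat (lk (m - xvar (a, i, \<beta>)) (a, j, \<beta>) + 1) * lk f (m - xvar (a, i, \<beta>) + xvar (a, j, \<beta>))
       else 0)"
proof -
  have "matrix_unit j i \<in> gl 0 N" using ij by (auto simp: gl_def matrix_unit_def)
  then have "lk (ad L N (diag (matrix_unit j i)) f) m = 0" using f by (simp add: P_fin_def)
  then show ?thesis
    unfolding ad_matrix_unit[OF ij] lookup_minus lookup_sum case_prod_unfold lookup_times_Var lookup_partial
    by simp
qed

section \<open>Invariants and the degrees of vertices\<close>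

text \<open>
  In the graph picture, \<open>rdeg\<close> and \<open>cdeg\<close> are the out-degree and the in-degree of a vertex.
\<close>

definition rdeg :: "nat \<Rightarrow> nat \<Rightarrow> (mvar \<Rightarrow>\<^sub>0 nat) \<Rightarrow> nat \<Rightarrow> nat" where
  "rdeg L N m i = (\<Sum>(b, \<beta>) \<in> {1..N} \<times> {1..L}. lk m (i, b, \<beta>))"

definition cdeg :: "nat \<Rightarrow> nat \<Rightarrow> (mvar \<Rightarrow>\<^sub>0 nat) \<Rightarrow> nat \<Rightarrow> nat" where
  "cdeg L N m j = (\<Sum>(a, \<beta>) \<in> {1..N} \<times> {1..L}. lk m (a, j, \<beta>))"

lemma rdeg_add: "rdeg L N (m + m') i = rdeg L N m i + rdeg L N m' i"
  by (simp add: rdeg_def lookup_add sum.distrib case_prod_unfold)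

lemma rdeg_xvar:
  assumes "(k, l, \<beta>) \<in> basis L N"
  shows "rdeg L N (xvar (k, l, \<beta>)) i = (if k = i then 1 else 0)"
proof -
  have "rdeg L N (xvar (k, l, \<beta>)) i =
      (\<Sum>p \<in> {1..N} \<times> {1..L}. if p = (l, \<beta>) then if k = i then 1 else 0 else 0)"
    unfolding rdeg_def by (rule sum.cong) (auto simp: lookup_xvar split: if_splits)
  then show ?thesis using assms by (simp add: sum.delta basis_def)
qed

lemma mon_degree_eq:
  assumes "finite A" "supp m \<subseteq> A"
  shows "mon_degree m = (\<Sum>x\<in>A. lk m x)"
  unfolding mon_degree_def using assms
  by (intro sum.mono_neutral_left) (auto simp: in_keys_iff)

lemma mon_degree_add: "mon_degree (m + m') = mon_degree m + mon_degree m'"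
proof -
  have "mon_degree k = (\<Sum>x\<in>supp m \<union> supp m'. lk k x)" if "supp k \<subseteq> supp m \<union> supp m'" for k
    using that by (intro mon_degree_eq) auto
  from this[of m] this[of m'] this[of "m + m'"] show ?thesis
    by (simp add: keys_add lookup_add sum.distrib)
qed

lemma mon_degree_xvar [simp]: "mon_degree (xvar x) = 1"
  by (simp add: mon_degree_def lookup_xvar)

lemma mon_degree_sum: "mon_degree (sum g A) = (\<Sum>x\<in>A. mon_degree (g x))"
  by (induction A rule: infinite_finite_induct) (auto simp: mon_degree_add mon_degree_def[of 0])

lemma mon_degree_rdeg:
  assumes "supp m \<subseteq> basis L N"
  shows "mon_degree m = (\<Sum>i=1..N. rdeg L N m i)"
  unfolding mon_degree_eq[OF finite_basis assms] rdeg_def basis_def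
  by (simp add: sum.cartesian_product case_prod_unfold)

lemma P_fin_supp:
  assumes "f \<in> P_fin d L N" "lk f m \<noteq> 0"
  shows "supp m \<subseteq> basis L N"
  using assms by (auto simp: P_fin_def Sym_def polys_in_def in_keys_iff)

text \<open>
  For \<open>i = j\<close> both sides of \<open>invariant_coefficient_identity\<close> are multiples of the same coefficient, by Euler's
  formula: the torus acts on \<open>m\<close> by the weight \<open>rdeg m i - cdeg m i\<close>.
\<close>

lemma invariant_balanced:
  assumes f: "f \<in> P_fin 0 L N" and m: "lk f m \<noteq> 0" and i: "i \<in> {1..N}"
  shows "rdeg L N m i = cdeg L N m i"
proof -
  have *: "(if lk m v > 0 then of_nat (lk (m - xvar v) v + 1) * lk f (m - xvar v + xvar v) else 0)
      = of_nat (lk m v) * lk f m" for v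
    using minus_xvar_eq_iff[of m v "m - xvar v"]
    by (auto simp: lookup_minus lookup_xvar of_nat_diff)
  have "of_nat (rdeg L N m i) * lk f m = (of_nat (cdeg L N m i) * lk f m :: complex)"
    using invariant_coefficient_identity[OF f i i, of m]
    unfolding * rdeg_def cdeg_def case_prod_unfold
    by (simp add: sum_distrib_right of_nat_sum)
  then show ?thesis using m by simp
qed

text \<open>
  If \<open>j\<close> is not the source of an edge of \<open>m\<close>, redirecting one edge \<open>i \<rightarrow> b\<close> to start at \<open>j\<close> produces a monomial
  \<open>m'\<close> in which only one row replacement can be undone, and the coefficient at \<open>m\<close> is expressed by
  monomials that arise from \<open>m'\<close> by moving the target of an edge from \<open>i\<close> to \<open>j\<close>.
\<close>

lemma replace_row_identity:
  assumes f: "f \<in> P_fin 0 L N" and ij: "i \<in> {1..N}" "j \<in> {1..N}" "i \<noteq> j"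
    and ib: "(i, b, \<beta>) \<in> basis L N"
    and j: "\<And>b \<beta>. lk m (j, b, \<beta>) = 0"
    and m: "m = m0 + xvar (i, b, \<beta>)" and m': "m' = m0 + xvar (j, b, \<beta>)"
  shows "of_nat (lk m (i, b, \<beta>)) * lk f m =
    (\<Sum>(a, \<gamma>) \<in> {1..N} \<times> {1..L}. if lk m' (a, i, \<gamma>) > 0
       then of_nat (lk (m' - xvar (a, i, \<gamma>)) (a, j, \<gamma>) + 1) * lk f (m' - xvar (a, i, \<gamma>) + xvar (a, j, \<gamma>))
       else 0)"
proof -
  have z: "lk m0 (j, c, \<gamma>) = 0" for c \<gamma>
    using j[of c \<gamma>] by (simp add: m lookup_add)
  have "(\<Sum>(c, \<gamma>) \<in> {1..N} \<times> {1..L}. if lk m' (j, c, \<gamma>) > 0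
       then of_nat (lk (m' - xvar (j, c, \<gamma>)) (i, c, \<gamma>) + 1) * lk f (m' - xvar (j, c, \<gamma>) + xvar (i, c, \<gamma>))
       else 0) = (\<Sum>p \<in> {1..N} \<times> {1..L}. if p = (b, \<beta>) then of_nat (lk m (i, b, \<beta>)) * lk f m else 0)"
    by (rule sum.cong) (auto simp: m m' z lookup_add lookup_xvar split: if_splits)
  also have "\<dots> = of_nat (lk m (i, b, \<beta>)) * lk f m"
    using ib by (simp add: sum.delta basis_def)
  finally show ?thesis
    using invariant_coefficient_identity[OF f ij(1,2), of m'] by simp
qed

text \<open>
  Among the monomials occurring in \<open>f\<close>, a monomial with the largest number of vertices leads to a
  contradiction: some vertex \<open>i\<close> has out-degree at least two, so fewer than \<open>n\<close> vertices occur and a free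
  vertex \<open>j\<close> exists. Splitting \<open>j\<close> off \<open>i\<close> leaves \<open>i\<close> with an outgoing edge, so that all monomials on the
  right-hand side of \<open>replace_row_identity\<close> have one vertex more.
\<close>

lemma invariant_eq_0_if_no_simple_monomial:
  assumes f: "f \<in> P_fin 0 L N" and hom: "homogeneous n f" and n: "n \<le> N"
    and simple: "\<And>m. \<forall>i\<in>{1..N}. rdeg L N m i \<le> 1 \<Longrightarrow> lk f m = 0"
  shows "f = 0"
proof -
  let ?V = "\<lambda>m. {i \<in> {1..N}. rdeg L N m i > 0}"
  have "lk f m = 0" for m
  proof (induction "N - card (?V m)" arbitrary: m rule: less_induct)
    case less
    show ?case
    proof (rule ccontr)
      assume nz: "lk f m \<noteq> 0"
      have supp: "supp m \<subseteq> basis L N" using P_fin_supp[OF f nz] .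
      obtain i where i: "i \<in> {1..N}" "rdeg L N m i \<ge> 2"
        using simple[of m] nz by force
      have "n = mon_degree m" using hom nz by (auto simp: homogeneous_def in_keys_iff)
      also have "\<dots> = (\<Sum>i=1..N. rdeg L N m i)" by (rule mon_degree_rdeg[OF supp])
      also have "\<dots> = (\<Sum>i\<in>?V m. rdeg L N m i)"
        by (intro sum.mono_neutral_right) auto
      finally have "n = (\<Sum>i\<in>?V m. rdeg L N m i)" .
      also have "\<dots> > (\<Sum>i\<in>?V m. 1)"
        using i by (intro sum_strict_mono_ex1) (auto simp: Suc_le_eq intro!: bexI[of _ i])
      finally have "card (?V m) < N" using n by simp
      then have "?V m \<noteq> {1..N}" by auto
      then obtain j where j: "j \<in> {1..N}" "rdeg L N m j = 0"
        by (metis (mono_tags, lifting) Collect_cong Collect_mem_eq gr0I)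
      have j0: "lk m (j, b, \<beta>) = 0" for b \<beta>
      proof (cases "(j, b, \<beta>) \<in> supp m")
        case True
        then have "(b, \<beta>) \<in> {1..N} \<times> {1..L}" using supp by (auto simp: basis_def)
        then show ?thesis using j(2) by (force simp: rdeg_def)
      qed (simp add: in_keys_iff)
      obtain b \<beta> where b: "(b, \<beta>) \<in> {1..N} \<times> {1..L}" "lk m (i, b, \<beta>) > 0"
      proof -
        have "\<exists>p\<in>{1..N} \<times> {1..L}. lk m (i, fst p, snd p) \<noteq> 0"
        proof (rule ccontr)
          assume "\<not> ?thesis"
          then have "rdeg L N m i = 0" by (auto simp: rdeg_def)
          then show False using i by simp
        qed
        then show ?thesis using that by auto
      qed
      have ij: "i \<noteq> j" using i j by auto
      define m0 where "m0 = m - xvar (i, b, \<beta>)"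
      define m' where "m' = m0 + xvar (j, b, \<beta>)"
      have m: "m = m0 + xvar (i, b, \<beta>)"
        using minus_xvar_eq_iff[OF b(2), of m0] by (simp add: m0_def)
      have ib: "(i, b, \<beta>) \<in> basis L N" and jb: "(j, b, \<beta>) \<in> basis L N"
        using i j b by (auto simp: basis_def)
      have "lk f (m' - xvar (a, i, \<gamma>) + xvar (a, j, \<gamma>)) = 0"
        if a: "(a, \<gamma>) \<in> {1..N} \<times> {1..L}" "lk m' (a, i, \<gamma>) > 0" for a \<gamma>
      proof (rule less.hyps)
        let ?m = "m' - xvar (a, i, \<gamma>) + xvar (a, j, \<gamma>)"
        have "m' = m' - xvar (a, i, \<gamma>) + xvar (a, i, \<gamma>)"
          using minus_xvar_eq_iff[OF a(2)] by blast
        moreover have ai: "(a, i, \<gamma>) \<in> basis L N" "(a, j, \<gamma>) \<in> basis L N"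
          using a i j by (auto simp: basis_def)
        ultimately have r: "rdeg L N ?m k = rdeg L N m' k" for k
          by (metis rdeg_add rdeg_xvar)
        \<comment> \<open>Moving a source changes out-degrees only at \<open>i\<close> and \<open>j\<close>; moving a target, as in \<open>r\<close>, changes none.\<close>
        have r': "rdeg L N m' k + (if k = i then 1 else 0) = rdeg L N m k + (if k = j then 1 else 0)" for k
          using ib jb by (auto simp: m m'_def rdeg_add rdeg_xvar)
        have "?V m \<subseteq> ?V ?m"
        proof safe
          fix k assume "0 < rdeg L N m k"
          then show "0 < rdeg L N ?m k"
            using r'[of k] i(2) ij unfolding r by (cases "k = i") (auto split: if_splits)
        qed
        moreover have "j \<in> ?V ?m" using r'[of j] ij j by (auto simp: r)
        moreover have "j \<notin> ?V m" using j by auto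
        ultimately have "?V m \<subset> ?V ?m" by blast
        then have "card (?V m) < card (?V ?m)" by (intro psubset_card_mono) auto
        moreover have "card (?V ?m) \<le> card {1..N}" by (intro card_mono) auto
        ultimately show "N - card (?V ?m) < N - card (?V m)" by simp
      qed
      then have "of_nat (lk m (i, b, \<beta>)) * lk f m = 0"
        unfolding replace_row_identity[OF f i(1) j(1) ij ib j0 m m'_def]
        by (intro sum.neutral) auto
      then show False using b nz by simp
    qed
  qed
  then show ?thesis by (intro poly_mapping_eqI) simp
qed

section \<open>Renaming vertices\<close>

text \<open>
  A labelled graph whose edges are indexed by \<open>K\<close>, so that parallel edges are counted with multiplicity. Sources
  \<open>r\<close> and targets \<open>c\<close> are independent functions because the arguments below move one end of an edge at a
  time.
\<close>

definition edges :: "'k set \<Rightarrow> ('k \<Rightarrow> nat) \<Rightarrow> ('k \<Rightarrow> nat) \<Rightarrow> ('k \<Rightarrow> nat) \<Rightarrow> mvar \<Rightarrow>\<^sub>0 nat" where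
  "edges K r c w = (\<Sum>\<kappa>\<in>K. xvar (r \<kappa>, c \<kappa>, w \<kappa>))"

lemma edges_cong:
  assumes "\<And>\<kappa>. \<kappa> \<in> K \<Longrightarrow> r \<kappa> = r' \<kappa>" "\<And>\<kappa>. \<kappa> \<in> K \<Longrightarrow> c \<kappa> = c' \<kappa>" "\<And>\<kappa>. \<kappa> \<in> K \<Longrightarrow> w \<kappa> = w' \<kappa>"
  shows "edges K r c w = edges K r' c' w'"
  unfolding edges_def using assms by (intro sum.cong) auto

lemma lookup_edges:
  assumes "finite K"
  shows "lk (edges K r c w) x = card {\<kappa>\<in>K. (r \<kappa>, c \<kappa>, w \<kappa>) = x}"
  using assms by (simp add: edges_def lookup_sum lookup_xvar sum.If_cases Int_def)

lemma lookup_edges_pos: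
  assumes "finite K"
  shows "lk (edges K r c w) x > 0 \<longleftrightarrow> (\<exists>\<kappa>\<in>K. (r \<kappa>, c \<kappa>, w \<kappa>) = x)"
  using assms by (auto simp: lookup_edges card_gt_0_iff)

lemma supp_edges:
  assumes "finite K"
  shows "supp (edges K r c w) = (\<lambda>\<kappa>. (r \<kappa>, c \<kappa>, w \<kappa>)) ` K"
  using lookup_edges_pos[OF assms, of r c w] by (auto simp: in_keys_iff)

lemma mon_degree_edges: "mon_degree (edges K r c w) = card K"
  by (simp add: edges_def mon_degree_sum)

lemma edges_remove:
  assumes "finite K" "\<kappa> \<in> K"
  shows "edges K r c w = edges (K - {\<kappa>}) r c w + xvar (r \<kappa>, c \<kappa>, w \<kappa>)"
  using assms by (simp add: edges_def sum.remove add.commute)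

text \<open>
  With all out-degrees equal to one, exactly one term survives on either side: the source of the edge \<open>\<kappa>\<close> is
  moved to \<open>j\<close> first, and then the only edge still ending at \<open>i\<close>, namely the one preceding \<open>\<kappa>\<close>, is redirected
  to \<open>j\<close>.
\<close>

lemma rename_vertex:
  assumes f: "f \<in> P_fin 0 L N" and K: "finite K" and \<sigma>: "bij_betw \<sigma> K K"
    and w: "w ` K \<subseteq> {1..L}" and inj: "inj_on a K" and a: "a ` K \<subseteq> {1..N}"
    and k: "\<kappa> \<in> K" and j: "j \<in> {1..N}" "j \<notin> a ` K"
  shows "lk f (edges K a (a \<circ> \<sigma>) w) = lk f (edges K (a(\<kappa> := j)) (a(\<kappa> := j) \<circ> \<sigma>) w)"
proof -
  define a' where "a' = a(\<kappa> := j)"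
  define m where "m = edges K a (a \<circ> \<sigma>) w"
  define m0 where "m0 = edges (K - {\<kappa>}) a (a \<circ> \<sigma>) w"
  define m' where "m' = edges K a' (a \<circ> \<sigma>) w"
  define i where "i = a \<kappa>"
  have \<sigma>K: "\<sigma> \<kappa>' \<in> K" if "\<kappa>' \<in> K" for \<kappa>' using \<sigma> that by (auto simp: bij_betw_def)
  have m: "m = m0 + xvar (i, a (\<sigma> \<kappa>), w \<kappa>)"
    unfolding m_def m0_def i_def edges_remove[OF K k] by simp
  have m'0: "m' = m0 + xvar (j, a (\<sigma> \<kappa>), w \<kappa>)"
    unfolding m'_def m0_def edges_remove[OF K k] by (auto simp: a'_def intro!: edges_cong split: if_splits)
  have i: "i \<in> {1..N}" "i \<noteq> j" using a k j by (auto simp: i_def)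
  have "{\<kappa>'\<in>K. (a \<kappa>', (a \<circ> \<sigma>) \<kappa>', w \<kappa>') = (i, a (\<sigma> \<kappa>), w \<kappa>)} = {\<kappa>}"
    using inj k by (auto simp: i_def inj_on_def)
  then have m1: "lk m (i, a (\<sigma> \<kappa>), w \<kappa>) = 1" using K by (simp add: m_def lookup_edges)
  have ib: "(i, a (\<sigma> \<kappa>), w \<kappa>) \<in> basis L N"
    using a w k \<sigma>K[OF k] i by (auto simp: basis_def)
  have j0: "lk m (j, b, \<beta>) = 0" for b \<beta>
    using lookup_edges_pos[OF K, of a "a \<circ> \<sigma>" w "(j, b, \<beta>)"] j by (auto simp: m_def)
  obtain \<kappa>1 where k1: "\<kappa>1 \<in> K" "\<sigma> \<kappa>1 = \<kappa>" using \<sigma> k by (metis bij_betw_imp_surj_on imageE)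
  have only: "\<kappa>' = \<kappa>1" if "\<kappa>' \<in> K" "a (\<sigma> \<kappa>') = i" for \<kappa>'
    using that \<sigma> inj k \<sigma>K[of \<kappa>'] k1 by (auto simp: i_def inj_on_def bij_betw_def)
  have pos: "lk m' (c, i, \<gamma>) > 0 \<longleftrightarrow> (c, \<gamma>) = (a' \<kappa>1, w \<kappa>1)" for c \<gamma>
  proof
    assume "lk m' (c, i, \<gamma>) > 0"
    then obtain \<kappa>' where "\<kappa>' \<in> K" "a' \<kappa>' = c" "a (\<sigma> \<kappa>') = i" "w \<kappa>' = \<gamma>"
      unfolding m'_def lookup_edges_pos[OF K] by auto
    with only[of \<kappa>'] show "(c, \<gamma>) = (a' \<kappa>1, w \<kappa>1)" by auto
  next
    assume "(c, \<gamma>) = (a' \<kappa>1, w \<kappa>1)"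
    then show "lk m' (c, i, \<gamma>) > 0"
      unfolding m'_def lookup_edges_pos[OF K] using k1 by (auto simp: i_def)
  qed
  define m1 where "m1 = edges (K - {\<kappa>1}) a' (a \<circ> \<sigma>) w"
  have m'1: "m' = m1 + xvar (a' \<kappa>1, i, w \<kappa>1)"
    unfolding m'_def m1_def edges_remove[OF K k1(1)] using k1 by (simp add: i_def)
  have l0: "lk m1 (a' \<kappa>1, j, w \<kappa>1) = 0"
  proof -
    have "\<not> lk m1 (a' \<kappa>1, j, w \<kappa>1) > 0"
      unfolding m1_def using K j \<sigma>K by (subst lookup_edges_pos) auto
    then show ?thesis by simp
  qed
  have fin: "m1 + xvar (a' \<kappa>1, j, w \<kappa>1) = edges K a' (a' \<circ> \<sigma>) w"
  proof -
    have "\<sigma> \<kappa>' \<noteq> \<kappa>" if "\<kappa>' \<in> K - {\<kappa>1}" for \<kappa>'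
      using that \<sigma> k1 by (auto simp: bij_betw_def inj_on_def)
    then have "m1 = edges (K - {\<kappa>1}) a' (a' \<circ> \<sigma>) w"
      unfolding m1_def by (intro edges_cong) (auto simp: a'_def)
    then show ?thesis
      unfolding edges_remove[OF K k1(1)] using k1 by (simp add: a'_def)
  qed
  have "lk f m = (\<Sum>(c, \<gamma>) \<in> {1..N} \<times> {1..L}. if lk m' (c, i, \<gamma>) > 0
       then of_nat (lk (m' - xvar (c, i, \<gamma>)) (c, j, \<gamma>) + 1) * lk f (m' - xvar (c, i, \<gamma>) + xvar (c, j, \<gamma>))
       else 0)"
    using replace_row_identity[OF f i(1) j(1) i(2) ib j0 m m'0] m1 by simp
  also have "\<dots> = (\<Sum>p \<in> {1..N} \<times> {1..L}. if p = (a' \<kappa>1, w \<kappa>1)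
       then lk f (edges K a' (a' \<circ> \<sigma>) w) else 0)"
    unfolding pos by (rule sum.cong) (auto simp: m'1 l0 fin split: if_splits)
  also have "\<dots> = lk f (edges K a' (a' \<circ> \<sigma>) w)"
    using a w k1 j by (auto simp: sum.delta a'_def)
  finally show ?thesis by (simp add: m_def a'_def)
qed

lemma rename_disjoint:
  assumes f: "f \<in> P_fin 0 L N" and K: "finite K" and \<sigma>: "bij_betw \<sigma> K K"
    and w: "w ` K \<subseteq> {1..L}" and inj: "inj_on a K" "inj_on b K"
    and a: "a ` K \<subseteq> {1..N}" "b ` K \<subseteq> {1..N}" and disj: "a ` K \<inter> b ` K = {}"
  shows "lk f (edges K a (a \<circ> \<sigma>) w) = lk f (edges K b (b \<circ> \<sigma>) w)"
proof -
  \<comment> \<open>The placement in which the points of \<open>A\<close> have already been moved.\<close>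
  define h where "h A \<kappa> = (if \<kappa> \<in> A then b \<kappa> else a \<kappa>)" for A \<kappa>
  define c where "c A = lk f (edges K (h A) (h A \<circ> \<sigma>) w)" for A
  have ab: "a x \<noteq> b y" if "x \<in> K" "y \<in> K" for x y
    using disj that by force
  have "c A = c {}" if "finite A" "A \<subseteq> K" for A
    using that
  proof (induction A rule: finite_induct)
    case (insert x A)
    then have x: "x \<in> K" "x \<notin> A" and A: "A \<subseteq> K" by auto
    have "inj_on (h A) K"
    proof (rule inj_onI)
      fix y z assume "y \<in> K" "z \<in> K" "h A y = h A z"
      then show "y = z"
        using inj ab[of y z] ab[of z y] by (auto simp: h_def inj_on_eq_iff split: if_splits)
    qed
    moreover have "h A ` K \<subseteq> {1..N}" "b x \<in> {1..N}" using a x by (auto simp: h_def)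
    moreover have "b x \<noteq> h A \<kappa>" if "\<kappa> \<in> K" for \<kappa>
    proof (cases "\<kappa> \<in> A")
      case True
      then show ?thesis using x that inj(2) by (auto simp: h_def inj_on_eq_iff)
    next
      case False
      then show ?thesis using ab[OF that x(1)] by (simp add: h_def)
    qed
    then have "b x \<notin> h A ` K" by blast
    ultimately have "c A = lk f (edges K ((h A)(x := b x)) ((h A)(x := b x) \<circ> \<sigma>) w)"
      unfolding c_def using x by (intro rename_vertex[OF f K \<sigma> w])
    also have "(h A)(x := b x) = h (insert x A)" by (auto simp: h_def)
    finally have "c A = c (insert x A)" by (simp only: c_def)
    then show ?case using insert.IH[OF A] by simp
  qed simp
  from this[OF K subset_refl] have "c K = c {}" .
  moreover have "edges K (h K) (h K \<circ> \<sigma>) w = edges K b (b \<circ> \<sigma>) w"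
    using \<sigma> by (intro edges_cong) (auto simp: bij_betw_def h_def)
  moreover have "h {} = a" by (auto simp: h_def)
  ultimately show ?thesis by (simp add: c_def)
qed

text \<open>
  Any two injective placements are connected through a third one that avoids both, for which
  \<open>3 * card K\<close> vertices are enough; disjoint placements are connected by renaming one vertex at a time.
\<close>

lemma coefficient_independent_of_indices:
  assumes f: "f \<in> P_fin 0 L N" and K: "finite K" and \<sigma>: "bij_betw \<sigma> K K"
    and w: "w ` K \<subseteq> {1..L}" and inj: "inj_on a K" "inj_on b K"
    and a: "a ` K \<subseteq> {1..N}" "b ` K \<subseteq> {1..N}" and N: "3 * card K \<le> N"
  shows "lk f (edges K a (a \<circ> \<sigma>) w) = lk f (edges K b (b \<circ> \<sigma>) w)"
proof -
  have "card K \<le> card ({1..N} - (a ` K \<union> b ` K))"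
  proof -
    have "card (a ` K \<union> b ` K) \<le> 2 * card K"
      using card_Un_le[of "a ` K" "b ` K"] card_image_le[OF K, of a] card_image_le[OF K, of b] by simp
    moreover have "card ({1..N} - (a ` K \<union> b ` K)) = N - card (a ` K \<union> b ` K)"
      using a K by (subst card_Diff_subset) auto
    ultimately show ?thesis using N by linarith
  qed
  then obtain c where c: "c ` K \<subseteq> {1..N} - (a ` K \<union> b ` K)" "inj_on c K"
    using card_le_inj[OF K, of "{1..N} - (a ` K \<union> b ` K)"] by auto
  have "lk f (edges K a (a \<circ> \<sigma>) w) = lk f (edges K c (c \<circ> \<sigma>) w)"
    using c inj a by (intro rename_disjoint[OF f K \<sigma> w]) auto
  moreover have "lk f (edges K b (b \<circ> \<sigma>) w) = lk f (edges K c (c \<circ> \<sigma>) w)"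
    using c inj a by (intro rename_disjoint[OF f K \<sigma> w]) auto
  ultimately show ?thesis by simp
qed

section \<open>Monomials that are disjoint unions of cycles\<close>

definition circ :: "nat \<Rightarrow> nat list \<Rightarrow> nat list set" where
  "circ L w = cyc_rel L `` {w}"

lemma equiv_cyc_rel: "equiv (words L) (cyc_rel L)"
proof (rule equivI)
  show "cyc_rel L \<subseteq> words L \<times> words L" by (auto simp: cyc_rel_def)
  show "refl_on (words L) (cyc_rel L)"
    by (auto simp: refl_on_def cyc_rel_def intro!: exI[of _ 0])
  show "sym (cyc_rel L)"
  proof (rule symI)
    fix u v assume "(u, v) \<in> cyc_rel L"
    then obtain k where u: "u \<in> words L" "v \<in> words L" "v = rotate k u" by (auto simp: cyc_rel_def)
    have "rotate (length u - k mod length u) v = rotate (length u) u"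
      using u by (subst u(3), subst rotate_conv_mod)
        (simp add: rotate_rotate words_def less_imp_le)
    then have "u = rotate (length u - k mod length u) v" by simp
    then show "(v, u) \<in> cyc_rel L" using u(1,2) unfolding cyc_rel_def by blast
  qed
  show "trans (cyc_rel L)"
    by (rule transI) (auto simp: cyc_rel_def rotate_rotate)
qed

lemma circ_in: "w \<in> words L \<Longrightarrow> circ L w \<in> circular_words L"
  by (simp add: circ_def circular_words_def quotientI)

lemma circ_eqI:
  assumes "u \<in> words L" "v \<in> words L" "rotate k u = rotate l v"
  shows "circ L u = circ L v"
proof -
  have "circ L x = circ L (rotate j x)" if "x \<in> words L" for x j
    unfolding circ_def using that
    by (intro equiv_class_eq[OF equiv_cyc_rel]) (auto simp: cyc_rel_def words_def)
  from this[of u k] this[of v l] show ?thesis using assms by simp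
qed

lemma circ_rep:
  assumes "c \<in> circular_words L"
  obtains w where "w \<in> words L" "c = circ L w"
  using assms by (auto simp: circular_words_def circ_def elim!: quotientE)

lemma p_circ_circ: "w \<in> words L \<Longrightarrow> p_circ (circ L w) = p_word w"
  and circ_length_circ: "w \<in> words L \<Longrightarrow> circ_length (circ L w) = length w"
  by (simp_all add: circ_def circ_class)

text \<open>
  A family \<open>W\<close> of words indexed by \<open>J\<close> is turned into one labelled permutation: the points are the positions in
  the words, and \<open>next_slot\<close> moves cyclically inside each word. Placing the points on vertices by \<open>a\<close>
  gives the monomial \<open>cycles_mon J W a\<close>. The index type is left free because cycles obtained from a
  monomial and cycles prescribed by a multiset of circular words are indexed differently.
\<close>

definition slots :: "'j set \<Rightarrow> ('j \<Rightarrow> nat list) \<Rightarrow> ('j \<times> nat) set" where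
  "slots J W = (SIGMA j:J. {..<length (W j)})"

definition next_slot :: "('j \<Rightarrow> nat list) \<Rightarrow> 'j \<times> nat \<Rightarrow> 'j \<times> nat" where
  "next_slot W = (\<lambda>(j, k). (j, Suc k mod length (W j)))"

definition letter :: "('j \<Rightarrow> nat list) \<Rightarrow> 'j \<times> nat \<Rightarrow> nat" where
  "letter W = (\<lambda>(j, k). W j ! k)"

definition cycles_mon :: "'j set \<Rightarrow> ('j \<Rightarrow> nat list) \<Rightarrow> ('j \<times> nat \<Rightarrow> nat) \<Rightarrow> mvar \<Rightarrow>\<^sub>0 nat" where
  "cycles_mon J W a = edges (slots J W) a (a \<circ> next_slot W) (letter W)"

text \<open>
  The multiset of circular words of a family, in the form of a monomial in the variables \<open>p_circ c\<close>.
\<close>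

definition word_type :: "nat \<Rightarrow> 'j set \<Rightarrow> ('j \<Rightarrow> nat list) \<Rightarrow> nat list set \<Rightarrow>\<^sub>0 nat" where
  "word_type L J W = (\<Sum>j\<in>J. xvar (circ L (W j)))"

lemma finite_slots [simp]: "finite J \<Longrightarrow> finite (slots J W)"
  by (simp add: slots_def)

lemma bij_next_slot:
  assumes "finite J"
  shows "bij_betw (next_slot W) (slots J W) (slots J W)"
proof -
  have "inj_on (next_slot W) (slots J W)"
    by (auto simp: inj_on_def next_slot_def slots_def mod_Suc split: if_splits)
  moreover have "next_slot W ` slots J W \<subseteq> slots J W"
    by (auto simp: next_slot_def slots_def intro: mod_less_divisor)
  ultimately show ?thesis
    using endo_inj_surj[of "slots J W"] assms by (simp add: bij_betw_def)
qed

lemma letter_range: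
  assumes "W ` J \<subseteq> words L"
  shows "letter W ` slots J W \<subseteq> {1..L}"
proof -
  have "W j ! k \<in> {1..L}" if "j \<in> J" "k < length (W j)" for j k
    using subsetD[OF assms imageI, OF that(1)] nth_mem[OF that(2)] unfolding words_def by blast
  then show ?thesis by (auto simp: letter_def slots_def)
qed

lemma next_slot_iterate:
  assumes "(j, k) \<in> slots J W"
  shows "(next_slot W ^^ i) (j, k) = (j, (k + i) mod length (W j))"
  using assms by (induction i) (auto simp: slots_def next_slot_def mod_Suc_eq)

lemma lookup_word_type:
  assumes "finite J"
  shows "lk (word_type L J W) c = card {j \<in> J. circ L (W j) = c}"
  using assms by (simp add: word_type_def lookup_sum lookup_xvar sum.If_cases Int_def)

lemma card_slots_of_class:
  assumes J: "finite J" and W: "W ` J \<subseteq> words L"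
  shows "card {\<kappa> \<in> slots J W. circ L (W (fst \<kappa>)) = c} = lk (word_type L J W) c * circ_length c"
proof -
  have "{\<kappa> \<in> slots J W. circ L (W (fst \<kappa>)) = c} =
      (SIGMA j:{j\<in>J. circ L (W j) = c}. {..<length (W j)})"
    by (auto simp: slots_def)
  then have "card {\<kappa> \<in> slots J W. circ L (W (fst \<kappa>)) = c} =
      (\<Sum>j\<in>{j\<in>J. circ L (W j) = c}. length (W j))"
    using J by simp
  also have "\<dots> = (\<Sum>j\<in>{j\<in>J. circ L (W j) = c}. circ_length c)"
  proof (rule sum.cong[OF refl])
    fix j assume "j \<in> {j\<in>J. circ L (W j) = c}"
    then show "length (W j) = circ_length c" using circ_length_circ[of "W j" L] W by auto
  qed
  also have "\<dots> = lk (word_type L J W) c * circ_length c"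
    by (simp add: lookup_word_type[OF J])
  finally show ?thesis .
qed

lemma supp_word_type:
  assumes "W ` J \<subseteq> words L"
  shows "supp (word_type L J W) \<subseteq> circular_words L"
  unfolding word_type_def using assms circ_in
  by (intro order_trans[OF keys_sum]) auto

text \<open>
  Injectivity of a placement is visible from the monomial, being equivalent to the number of sources of
  edges being equal to the degree.
\<close>

lemma cycles_mon_inj:
  assumes fin: "finite J" "finite J'"
    and inj': "inj_on a' (slots J' W')" and eq: "cycles_mon J W a = cycles_mon J' W' a'"
  shows "inj_on a (slots J W)"
proof -
  let ?K = "slots J W" and ?K' = "slots J' W'"
  have finK: "finite ?K" "finite ?K'" using fin by auto
  have card: "card ?K = card ?K'"
    using arg_cong[OF eq, of mon_degree] by (simp add: cycles_mon_def mon_degree_edges)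
  have "fst ` supp (cycles_mon J W a) = fst ` supp (cycles_mon J' W' a')" by (simp only: eq)
  then have "a ` ?K = a' ` ?K'"
    using finK by (simp add: cycles_mon_def supp_edges image_image)
  then show ?thesis
    using card card_image[OF inj'] finK by (intro eq_card_imp_inj_on) auto
qed

text \<open>
  Since \<open>a'\<close> is injective, every point \<open>\<kappa>\<close> has a unique partner \<open>\<theta> \<kappa>\<close> placed at the same vertex, and comparing
  edges shows that \<open>\<theta>\<close> commutes with the successor maps and preserves letters. Following \<open>\<theta>\<close> around a cycle
  identifies the word of the cycle with a rotation of its partner's word. The number of cycles of a given
  class is then obtained by counting points.
\<close>

lemma cycles_mon_determines_type:
  assumes fin: "finite J" "finite J'" and W: "W ` J \<subseteq> words L" "W' ` J' \<subseteq> words L"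
    and inj': "inj_on a' (slots J' W')" and eq: "cycles_mon J W a = cycles_mon J' W' a'"
  shows "word_type L J W = word_type L J' W'"
proof -
  let ?K = "slots J W" and ?K' = "slots J' W'"
  let ?n = "next_slot W" and ?n' = "next_slot W'"
  have finK: "finite ?K" "finite ?K'" using fin by auto
  have card: "card ?K = card ?K'"
    using arg_cong[OF eq, of mon_degree] by (simp add: cycles_mon_def mon_degree_edges)
  have supp: "(\<lambda>\<kappa>. (a \<kappa>, a (?n \<kappa>), letter W \<kappa>)) ` ?K = (\<lambda>\<kappa>. (a' \<kappa>, a' (?n' \<kappa>), letter W' \<kappa>)) ` ?K'"
    using arg_cong[OF eq, of supp] finK by (simp add: cycles_mon_def supp_edges)
  have inj: "inj_on a ?K" by (rule cycles_mon_inj[OF fin inj' eq])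
  have "\<exists>\<kappa>'\<in>?K'. a' \<kappa>' = a \<kappa> \<and> a' (?n' \<kappa>') = a (?n \<kappa>) \<and> letter W' \<kappa>' = letter W \<kappa>"
    if "\<kappa> \<in> ?K" for \<kappa>
  proof -
    have "(a \<kappa>, a (?n \<kappa>), letter W \<kappa>) \<in> (\<lambda>\<kappa>. (a' \<kappa>, a' (?n' \<kappa>), letter W' \<kappa>)) ` ?K'"
      using that supp by blast
    then show ?thesis by auto
  qed
  then obtain \<theta> where \<theta>: "\<And>\<kappa>. \<kappa> \<in> ?K \<Longrightarrow> \<theta> \<kappa> \<in> ?K'" "\<And>\<kappa>. \<kappa> \<in> ?K \<Longrightarrow> a' (\<theta> \<kappa>) = a \<kappa>"
    "\<And>\<kappa>. \<kappa> \<in> ?K \<Longrightarrow> a' (?n' (\<theta> \<kappa>)) = a (?n \<kappa>)" "\<And>\<kappa>. \<kappa> \<in> ?K \<Longrightarrow> letter W' (\<theta> \<kappa>) = letter W \<kappa>"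
    by metis
  have nK: "?n \<kappa> \<in> ?K" if "\<kappa> \<in> ?K" for \<kappa>
    using bij_next_slot[OF fin(1)] that by (rule bij_betw_apply)
  have nK': "?n' \<kappa> \<in> ?K'" if "\<kappa> \<in> ?K'" for \<kappa>
    using bij_next_slot[OF fin(2)] that by (rule bij_betw_apply)
  have \<theta>n: "\<theta> (?n \<kappa>) = ?n' (\<theta> \<kappa>)" if "\<kappa> \<in> ?K" for \<kappa>
    using inj_onD[OF inj', of "\<theta> (?n \<kappa>)" "?n' (\<theta> \<kappa>)"] \<theta> nK nK' that by simp
  have iter_in: "(?n ^^ i) \<kappa> \<in> ?K" if "\<kappa> \<in> ?K" for i \<kappa>
    using that nK by (induction i) auto
  have \<theta>iter: "\<theta> ((?n ^^ i) \<kappa>) = (?n' ^^ i) (\<theta> \<kappa>)" if "\<kappa> \<in> ?K" for i \<kappa>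
    using that by (induction i) (auto simp: \<theta>n iter_in)
  have \<theta>inj: "inj_on \<theta> ?K"
    by (rule inj_onI) (metis \<theta>(2) inj inj_onD)
  moreover have "\<theta> ` ?K = ?K'"
    using \<theta>(1) card finK card_image[OF \<theta>inj] by (intro card_subset_eq) auto
  ultimately have "bij_betw \<theta> ?K ?K'" by (simp add: bij_betw_def)
  have same: "circ L (W' (fst (\<theta> \<kappa>))) = circ L (W (fst \<kappa>))" if "\<kappa> \<in> ?K" for \<kappa>
  proof -
    obtain j k j' k' where jk: "\<kappa> = (j, k)" "\<theta> \<kappa> = (j', k')" by (metis surj_pair)
    have K: "(j, k) \<in> ?K" "(j', k') \<in> ?K'" using that \<theta>(1)[OF that] jk by auto
    then have j: "k < length (W j)" "k' < length (W' j')" "W j \<in> words L" "W' j' \<in> words L"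
      using W by (auto simp: slots_def)
    have step: "\<theta> (j, (k + i) mod length (W j)) = (j', (k' + i) mod length (W' j'))" for i
      using \<theta>iter[OF that, of i] unfolding jk next_slot_iterate[OF K(1)]
      using jk next_slot_iterate[OF K(2), of i] by simp
    \<comment> \<open>A cycle returns to its start after \<open>r\<close> steps only if its length divides \<open>r\<close>.\<close>
    have dv: "q dvd r" if "(x + r) mod q = x" for x r q :: nat
      using that by (metis add_diff_cancel_left' dvd_triv_left minus_mod_eq_mult_div mod_eq_dvd_iff_nat mod_mod_trivial le_add1)
    have "(k' + length (W j)) mod length (W' j') = k'"
      using step[of "length (W j)"] jk j by simp
    then have d1: "length (W' j') dvd length (W j)" by (rule dv)
    have "\<theta> (j, (k + length (W' j')) mod length (W j)) = \<theta> (j, k)"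
      using step[of "length (W' j')"] jk j by simp
    then have "(j, (k + length (W' j')) mod length (W j)) = (j, k)"
      using \<theta>inj K j iter_in[OF K(1), of "length (W' j')"] unfolding next_slot_iterate[OF K(1)]
      by (auto dest: inj_onD)
    then have "length (W j) dvd length (W' j')" by (intro dv[of k]) simp
    with d1 have len: "length (W' j') = length (W j)" by (rule dvd_antisym)
    have "rotate k (W j) = rotate k' (W' j')"
    proof (rule nth_equalityI)
      fix i assume "i < length (rotate k (W j))"
      then have i: "i < length (W j)" by simp
      have "letter W' (\<theta> (j, (k + i) mod length (W j))) = letter W (j, (k + i) mod length (W j))"
        using iter_in[OF K(1), of i] unfolding next_slot_iterate[OF K(1)] by (rule \<theta>(4))
      then show "rotate k (W j) ! i = rotate k' (W' j') ! i"
        unfolding step using i len by (simp add: nth_rotate letter_def)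
    qed (simp add: len)
    then show ?thesis using circ_eqI[OF j(3,4)] jk by simp
  qed
  show ?thesis
  proof (rule poly_mapping_eqI)
    fix c
    have "\<theta> ` {\<kappa> \<in> ?K. circ L (W (fst \<kappa>)) = c} = {\<kappa> \<in> ?K'. circ L (W' (fst \<kappa>)) = c}"
    proof (intro equalityI subsetI)
      fix x assume "x \<in> {\<kappa> \<in> ?K'. circ L (W' (fst \<kappa>)) = c}"
      moreover then obtain y where "y \<in> ?K" "x = \<theta> y"
        using bij_betw_imp_surj_on[OF \<open>bij_betw \<theta> ?K ?K'\<close>] by blast
      ultimately show "x \<in> \<theta> ` {\<kappa> \<in> ?K. circ L (W (fst \<kappa>)) = c}" using same by auto
    qed (use same \<theta>(1) in auto)
    then have "card {\<kappa> \<in> ?K. circ L (W (fst \<kappa>)) = c} = card {\<kappa> \<in> ?K'. circ L (W' (fst \<kappa>)) = c}"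
      using card_image[of \<theta> "{\<kappa> \<in> ?K. circ L (W (fst \<kappa>)) = c}"] \<theta>inj
      by (metis (no_types, lifting) inj_on_subset mem_Collect_eq subsetI)
    then have *: "lk (word_type L J W) c * circ_length c = lk (word_type L J' W') c * circ_length c"
      using card_slots_of_class[OF fin(1) W(1)] card_slots_of_class[OF fin(2) W(2)] by simp
    show "lk (word_type L J W) c = lk (word_type L J' W') c"
    proof (cases "c \<in> circular_words L")
      case True
      then have "circ_length c > 0"
        by (elim circ_rep) (auto simp: circ_length_circ words_def)
      then show ?thesis using * by simp
    next
      case False
      then show ?thesis
        using supp_word_type[OF W(1)] supp_word_type[OF W(2)] by (metis in_keys_iff subsetD)
    qed
  qed
qed

section \<open>Decomposing a simple balanced monomial into cycles\<close>

text \<open>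
  The inductive description of a cycle decomposition, made explicit as a set of lists. An empty list may occur
  as a cycle there; it contributes no point and is discarded.
\<close>

lemma cycle_decomp_lists:
  assumes "cycle_decomp I p"
  shows "p permutes I \<and> (\<exists>C. finite C \<and> (\<forall>c\<in>C. distinct c \<and> c \<noteq> []) \<and>
    (\<forall>c\<in>C. \<forall>d\<in>C. c \<noteq> d \<longrightarrow> set c \<inter> set d = {}) \<and> \<Union>(set ` C) = I \<and>
    (\<forall>c\<in>C. \<forall>k<length c. p (c ! k) = c ! (Suc k mod length c)))"
  using assms
proof (induction rule: cycle_decomp.induct)
  case empty
  show ?case by (auto simp: permutes_id intro!: exI[of _ "{}"])
next
  case (comp I p cs)
  then obtain C where C: "p permutes I" "finite C" "\<forall>c\<in>C. distinct c \<and> c \<noteq> []"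
    "\<forall>c\<in>C. \<forall>d\<in>C. c \<noteq> d \<longrightarrow> set c \<inter> set d = {}" "\<Union>(set ` C) = I"
    "\<forall>c\<in>C. \<forall>k<length c. p (c ! k) = c ! (Suc k mod length c)" by blast
  have perm: "cycle_of_list cs \<circ> p permutes set cs \<union> I"
    by (rule permutes_compose)
      (use C(1) cycle_permutes[of cs] in \<open>auto intro: permutes_subset\<close>)
  define C' where "C' = (if cs = [] then C else insert cs C)"
  have old: "(cycle_of_list cs \<circ> p) (c ! k) = c ! (Suc k mod length c)" if "c \<in> C" "k < length c" for c k
  proof -
    have "c ! (Suc k mod length c) \<in> set c" using that by (intro nth_mem mod_less_divisor) auto
    then have "c ! (Suc k mod length c) \<notin> set cs" using comp(3) C(5) that by auto
    then show ?thesis using C(6) that id_outside_supp by fastforce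
  qed
  have new: "(cycle_of_list cs \<circ> p) (cs ! k) = cs ! (Suc k mod length cs)" if "k < length cs" for k
  proof -
    have "cs ! k \<notin> I" using that comp(3) nth_mem by blast
    then have "p (cs ! k) = cs ! k" using C(1) by (simp add: permutes_def)
    moreover have "map (cycle_of_list cs) cs = rotate1 cs"
      using cyclic_rotation[OF comp(2), of 1] by simp
    then have "cycle_of_list cs (cs ! k) = rotate1 cs ! k" using that by (metis nth_map)
    ultimately show ?thesis using that by (simp add: nth_rotate1)
  qed
  have "finite C'" "\<forall>c\<in>C'. distinct c \<and> c \<noteq> []" "\<Union>(set ` C') = set cs \<union> I"
    using C comp(2) by (auto simp: C'_def)
  moreover have "\<forall>c\<in>C'. \<forall>d\<in>C'. c \<noteq> d \<longrightarrow> set c \<inter> set d = {}"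
    using C(4,5) comp(3) by (auto simp: C'_def)
  moreover have "\<forall>c\<in>C'. \<forall>k<length c. (cycle_of_list cs \<circ> p) (c ! k) = c ! (Suc k mod length c)"
    using old new by (auto simp: C'_def simp del: o_apply split: if_splits)
  ultimately show ?case using perm by blast
qed

lemma lookup_le_rdeg:
  assumes "supp m \<subseteq> basis L N" "A \<subseteq> {x \<in> supp m. fst x = i}"
  shows "(\<Sum>x\<in>A. lk m x) \<le> rdeg L N m i"
proof -
  let ?g = "\<lambda>(b, \<beta>). (i, b, \<beta>)"
  have "(\<Sum>x\<in>A. lk m x) \<le> (\<Sum>x\<in>?g ` ({1..N} \<times> {1..L}). lk m x)"
  proof (rule sum_mono2)
    show "A \<subseteq> ?g ` ({1..N} \<times> {1..L})"
      using assms by (fastforce simp: basis_def)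
  qed auto
  also have "\<dots> = rdeg L N m i"
    unfolding rdeg_def by (subst sum.reindex) (auto simp: inj_on_def case_prod_unfold)
  finally show ?thesis .
qed

lemma lookup_le_cdeg:
  assumes "supp m \<subseteq> basis L N" "A \<subseteq> {x \<in> supp m. fst (snd x) = j}"
  shows "(\<Sum>x\<in>A. lk m x) \<le> cdeg L N m j"
proof -
  let ?g = "\<lambda>(a, \<beta>). (a, j, \<beta>)"
  have "(\<Sum>x\<in>A. lk m x) \<le> (\<Sum>x\<in>?g ` ({1..N} \<times> {1..L}). lk m x)"
  proof (rule sum_mono2)
    show "A \<subseteq> ?g ` ({1..N} \<times> {1..L})"
      using assms by (fastforce simp: basis_def)
  qed auto
  also have "\<dots> = cdeg L N m j"
    unfolding cdeg_def by (subst sum.reindex) (auto simp: inj_on_def case_prod_unfold)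
  finally show ?thesis .
qed

text \<open>
  If all degrees are at most one, the edges form the graph of a permutation of the occurring vertices. Its
  cycles, written as lists of vertices, index the family of words, so a slot \<open>(c, k)\<close> is placed at
  the vertex \<open>c ! k\<close>.
\<close>

lemma simple_balanced_is_cycles_mon:
  assumes supp: "supp m \<subseteq> basis L N"
    and bal: "\<And>i. i \<in> {1..N} \<Longrightarrow> rdeg L N m i = cdeg L N m i"
    and simple: "\<And>i. i \<in> {1..N} \<Longrightarrow> rdeg L N m i \<le> 1"
  obtains C :: "nat list set" and W a where "finite C" "W ` C \<subseteq> words L"
    "inj_on a (slots C W)" "a ` slots C W \<subseteq> {1..N}" "cycles_mon C W a = m"
proof -
  let ?S = "supp m" and ?V = "{i \<in> {1..N}. rdeg L N m i > 0}" and ?c = "\<lambda>x. fst (snd x)"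
  have S: "fst x \<in> {1..N}" "?c x \<in> {1..N}" "snd (snd x) \<in> {1..L}" "lk m x > 0" if "x \<in> ?S" for x
    using subsetD[OF supp that] that by (cases x; auto simp: basis_def in_keys_iff)+
  have one: "lk m x = 1" if "x \<in> ?S" for x
    using lookup_le_rdeg[OF supp, of "{x}" "fst x"] simple[of "fst x"] S[OF that] that by simp
  have injr: "inj_on fst ?S"
  proof (rule inj_onI, rule ccontr)
    fix x y assume "x \<in> ?S" "y \<in> ?S" "fst x = fst y" "x \<noteq> y"
    then show False
      using lookup_le_rdeg[OF supp, of "{x, y}" "fst x"] simple[of "fst x"] S[of x] S[of y] by auto
  qed
  have injc: "inj_on ?c ?S"
  proof (rule inj_onI, rule ccontr)
    fix x y assume "x \<in> ?S" "y \<in> ?S" "?c x = ?c y" "x \<noteq> y"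
    then show False
      using lookup_le_cdeg[OF supp, of "{x, y}" "?c x"] simple[of "?c x"] bal[of "?c x"] S[of x] S[of y] by auto
  qed
  have rimg: "fst ` ?S = ?V"
  proof (intro equalityI subsetI)
    fix v assume "v \<in> fst ` ?S"
    then obtain x where "x \<in> ?S" "v = fst x" by blast
    then show "v \<in> ?V" using lookup_le_rdeg[OF supp, of "{x}" "fst x"] S[of x] by auto
  next
    fix v assume "v \<in> ?V"
    then have "rdeg L N m v \<noteq> 0" by simp
    then obtain b \<beta> where "lk m (v, b, \<beta>) \<noteq> 0"
      unfolding rdeg_def by (rule sum.not_neutral_contains_not_neutral) auto
    then show "v \<in> fst ` ?S" by (force simp: in_keys_iff)
  qed
  have cimg: "?c ` ?S = ?V"
  proof (intro equalityI subsetI)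
    fix v assume "v \<in> ?c ` ?S"
    then obtain x where "x \<in> ?S" "v = ?c x" by blast
    then show "v \<in> ?V" using lookup_le_cdeg[OF supp, of "{x}" "?c x"] S[of x] bal[of v] by auto
  next
    fix v assume "v \<in> ?V"
    then have "cdeg L N m v \<noteq> 0" using bal by auto
    then obtain b \<beta> where "lk m (b, v, \<beta>) \<noteq> 0"
      unfolding cdeg_def by (rule sum.not_neutral_contains_not_neutral) auto
    then show "v \<in> ?c ` ?S" by (force simp: in_keys_iff)
  qed
  define e where "e = inv_into ?S fst"
  have e: "bij_betw e ?V ?S" unfolding e_def
    by (rule bij_betw_inv_into) (simp add: bij_betw_def injr rimg)
  have fst_e: "fst (e v) = v" if "v \<in> ?V" for v
    using that rimg unfolding e_def by (intro f_inv_into_f) simp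
  define \<sigma> where "\<sigma> v = (if v \<in> ?V then ?c (e v) else v)" for v
  define lab where "lab v = snd (snd (e v))" for v
  have "bij_betw (?c \<circ> e) ?V ?V"
    using e by (rule bij_betw_trans) (simp add: bij_betw_def injc cimg)
  then have "bij_betw \<sigma> ?V ?V"
    by (rule iffD1[OF bij_betw_cong, rotated]) (simp add: \<sigma>_def)
  then have "\<sigma> permutes ?V" by (rule bij_imp_permutes) (auto simp: \<sigma>_def)
  then have "cycle_decomp ?V \<sigma>" by (rule cycle_decomposition) simp
  from conjunct2[OF cycle_decomp_lists[OF this]]
  obtain C where C: "finite C" "\<forall>c\<in>C. distinct c \<and> c \<noteq> []"
    "\<forall>c\<in>C. \<forall>d\<in>C. c \<noteq> d \<longrightarrow> set c \<inter> set d = {}" "\<Union>(set ` C) = ?V"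
    "\<forall>c\<in>C. \<forall>k<length c. \<sigma> (c ! k) = c ! (Suc k mod length c)"
    by (elim exE conjE) (rule that)
  define W where "W = map lab"
  define a where "a = (\<lambda>(c, k). c ! k :: nat)"
  have K: "(c, k) \<in> slots C W \<longleftrightarrow> c \<in> C \<and> k < length c" for c k
    by (simp add: slots_def W_def)
  have lab: "lab v \<in> {1..L}" if "v \<in> ?V" for v
    using S(3)[of "e v"] e that by (auto simp: lab_def bij_betw_def)
  have Wwords: "W ` C \<subseteq> words L"
  proof
    fix w assume "w \<in> W ` C"
    then obtain c where c: "c \<in> C" "w = map lab c" by (auto simp: W_def)
    then have "set c \<subseteq> ?V" using C(4) by blast
    then have "set w \<subseteq> {1..L}" using c lab by auto
    then show "w \<in> words L" using c C(2) by (auto simp: words_def)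
  qed
  have inj: "inj_on a (slots C W)"
  proof (rule inj_onI)
    fix x y assume xy: "x \<in> slots C W" "y \<in> slots C W" "a x = a y"
    obtain c k d l where x: "x = (c, k)" "y = (d, l)" by (metis surj_pair)
    then have *: "c \<in> C" "k < length c" "d \<in> C" "l < length d" "c ! k = d ! l"
      using xy by (auto simp: K a_def)
    then have "c ! k \<in> set c \<inter> set d" by (metis IntI nth_mem)
    then have "c = d" using C(3) * by blast
    then show "x = y" using * C(2) x by (simp add: nth_eq_iff_index_eq)
  qed
  have img: "a ` slots C W = ?V"
  proof -
    have "a ` slots C W = \<Union>(set ` C)"
    proof (intro equalityI subsetI)
      fix v assume "v \<in> a ` slots C W"
      then obtain c k where "(c, k) \<in> slots C W" "v = c ! k" by (auto simp: a_def)
      then show "v \<in> \<Union>(set ` C)" unfolding K using nth_mem by blast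
    next
      fix v assume "v \<in> \<Union>(set ` C)"
      then obtain c k where "c \<in> C" "k < length c" "v = c ! k" by (metis UN_E in_set_conv_nth)
      then show "v \<in> a ` slots C W" using K[of c k] by (force simp: a_def)
    qed
    then show ?thesis using C(4) by simp
  qed
  have "cycles_mon C W a = (\<Sum>\<kappa>\<in>slots C W. xvar (e (a \<kappa>)))"
    unfolding cycles_mon_def edges_def
  proof (rule sum.cong[OF refl])
    fix \<kappa> assume k: "\<kappa> \<in> slots C W"
    then obtain c k where \<kappa>: "\<kappa> = (c, k)" "c \<in> C" "k < length c" by (metis K surj_pair)
    have v: "c ! k \<in> ?V" using k img \<kappa> by (auto simp: a_def)
    have "c ! (Suc k mod length c) = ?c (e (c ! k))" using v C(5) \<kappa>(2,3) by (metis \<sigma>_def)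
    then have "(a \<kappa>, (a \<circ> next_slot W) \<kappa>, letter W \<kappa>) = (fst (e (c ! k)), ?c (e (c ! k)), snd (snd (e (c ! k))))"
      using \<kappa> fst_e[OF v] by (simp add: a_def next_slot_def letter_def W_def lab_def)
    then show "xvar (a \<kappa>, (a \<circ> next_slot W) \<kappa>, letter W \<kappa>) = xvar (e (a \<kappa>))"
      using \<kappa> by (simp add: a_def)
  qed
  also have "\<dots> = (\<Sum>v\<in>?V. xvar (e v))"
    by (rule sum.reindex_bij_betw) (simp add: bij_betw_def inj img)
  also have "\<dots> = (\<Sum>x\<in>?S. xvar x)"
    by (rule sum.reindex_bij_betw[OF e])
  also have "\<dots> = m"
  proof (rule poly_mapping_eqI)
    fix x show "lk (\<Sum>x\<in>?S. xvar x) x = lk m x"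
      using one[of x] by (cases "x \<in> ?S") (auto simp: lookup_sum lookup_xvar in_keys_iff)
  qed
  finally have "cycles_mon C W a = m" .
  moreover have "a ` slots C W \<subseteq> {1..N}" using img by auto
  ultimately show ?thesis using that C(1) Wwords inj by blast
qed

section \<open>Invariance of trace functions\<close>

text \<open>
  The sum over all placements of a labelled permutation. For the permutation of a family of words it is the
  product of the corresponding \<open>p_word\<close>, and it is treated as a single sum because invariance,
  degree and behaviour under projection are no harder to see for the product than for one factor.
\<close>

definition labelled_trace :: "'k set \<Rightarrow> ('k \<Rightarrow> 'k) \<Rightarrow> ('k \<Rightarrow> nat) \<Rightarrow> nat \<Rightarrow> mvar mpol" where
  "labelled_trace K \<sigma> w N =
     (\<Sum>a \<in> K \<rightarrow>\<^sub>E {1..N}. Poly_Mapping.single (edges K a (a \<circ> \<sigma>) w) 1)"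

lemma lookup_labelled_trace:
  assumes "finite K"
  shows "lk (labelled_trace K \<sigma> w N) m = of_nat (card {a \<in> K \<rightarrow>\<^sub>E {1..N}. edges K a (a \<circ> \<sigma>) w = m})"
  using finite_PiE[OF assms, of "\<lambda>_. {1..N}"]
  by (simp add: labelled_trace_def lookup_sum lookup_single when_def sum.If_cases Int_def)

text \<open>
  Every placement contributes \<open>1\<close>, so no cancellation takes place.
\<close>

lemma lookup_labelled_trace_nonzero:
  assumes "finite K"
  shows "lk (labelled_trace K \<sigma> w N) m \<noteq> 0 \<longleftrightarrow> (\<exists>a \<in> K \<rightarrow>\<^sub>E {1..N}. edges K a (a \<circ> \<sigma>) w = m)"
  using finite_PiE[OF assms, of "\<lambda>_. {1..N}"] unfolding lookup_labelled_trace[OF assms] by auto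

lemma supp_edges_basis:
  assumes "finite K" "\<sigma> ` K \<subseteq> K" "w ` K \<subseteq> {1..L}"
  shows "supp (edges K a (a \<circ> \<sigma>) w) \<subseteq> basis L N \<longleftrightarrow> a ` K \<subseteq> {1..N}"
proof -
  have "\<sigma> \<kappa> \<in> K" "w \<kappa> \<in> {1..L}" if "\<kappa> \<in> K" for \<kappa> using assms that by auto
  then show ?thesis
    unfolding supp_edges[OF assms(1)] image_subset_iff basis_def mem_Times_iff fst_conv snd_conv o_apply
    by blast
qed

lemma labelled_trace_Sym:
  assumes "finite K" "\<sigma> ` K \<subseteq> K" "w ` K \<subseteq> {1..L}"
  shows "labelled_trace K \<sigma> w N \<in> Sym L N"
proof -
  have "supp m \<subseteq> basis L N" if m: "m \<in> supp (labelled_trace K \<sigma> w N)" for m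
  proof -
    obtain a where "a \<in> K \<rightarrow>\<^sub>E {1..N}" "edges K a (a \<circ> \<sigma>) w = m"
      using m unfolding in_keys_iff lookup_labelled_trace_nonzero[OF assms(1)] by blast
    then show ?thesis using supp_edges_basis[OF assms, of a N] by (auto simp: PiE_iff)
  qed
  then show ?thesis by (auto simp: Sym_def polys_in_def)
qed

lemma labelled_trace_homogeneous:
  assumes "finite K"
  shows "homogeneous (card K) (labelled_trace K \<sigma> w N)"
  unfolding homogeneous_def
proof
  fix m assume "m \<in> supp (labelled_trace K \<sigma> w N)"
  then obtain a where "edges K a (a \<circ> \<sigma>) w = m"
    unfolding in_keys_iff lookup_labelled_trace_nonzero[OF assms] by blast
  then show "mon_degree m = card K" using mon_degree_edges by blast
qed

lemma partial_add: "partial v (f + g) = partial v f + partial v g"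
  by (intro poly_mapping_eqI) (simp add: lookup_add lookup_partial algebra_simps)

lemma partial_diff: "partial v (f - g) = partial v f - partial v g"
  by (intro poly_mapping_eqI) (simp add: lookup_minus lookup_partial algebra_simps)

lemma ad_add: "ad L N A (f + g) = ad L N A f + ad L N A g"
  by (simp add: ad_def partial_add distrib_right sum.distrib)

lemma ad_diff: "ad L N A (f - g) = ad L N A f - ad L N A g"
  by (simp add: ad_def partial_diff left_diff_distrib sum_subtractf)

lemma ad_zero [simp]: "ad L N A 0 = 0"
  by (simp add: ad_def partial_def)

lemma ad_sum: "ad L N A (sum g I) = (\<Sum>x\<in>I. ad L N A (g x))"
  by (induction I rule: infinite_finite_induct) (simp_all add: ad_add)

lemma partial_single:
  "partial v (Poly_Mapping.single m 1) = of_nat (lk m v) * Poly_Mapping.single (m - xvar v) 1"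
  by (simp add: partial_def single_of_nat[symmetric] mult_single xvar_def del: single_of_nat)

text \<open>
  By the product rule, \<open>X\<close> acts on each edge in turn, moving its source or its target to an arbitrary vertex.
\<close>

lemma ad_edges:
  assumes K: "finite K" and E: "\<And>\<kappa>. \<kappa> \<in> K \<Longrightarrow> (r \<kappa>, c \<kappa>, w \<kappa>) \<in> basis L N"
  shows "ad L N (diag X) (Poly_Mapping.single (edges K r c w) 1) =
    (\<Sum>\<kappa>\<in>K. \<Sum>s=1..N. Const (X s (r \<kappa>)) * Poly_Mapping.single (edges K (r(\<kappa> := s)) c w) 1) -
    (\<Sum>\<kappa>\<in>K. \<Sum>s=1..N. Const (X (c \<kappa>) s) * Poly_Mapping.single (edges K r (c(\<kappa> := s)) w) 1)"
proof -
  let ?m = "edges K r c w" and ?x = "\<lambda>\<kappa>. (r \<kappa>, c \<kappa>, w \<kappa>)"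
  define F where "F = (\<lambda>(i, j, \<alpha>::nat). (\<Sum>s=1..N. Const (X s i) * Var (s, j, \<alpha>)) - (\<Sum>s=1..N. Const (X j s) * Var (i, s, \<alpha>)))"
  have "ad L N (diag X) (Poly_Mapping.single ?m 1) =
      (\<Sum>v\<in>basis L N. of_nat (lk ?m v) * Poly_Mapping.single (?m - xvar v) 1 * F v)"
    by (simp add: ad_diag partial_single F_def case_prod_unfold)
  also have "\<dots> = (\<Sum>v\<in>basis L N. \<Sum>\<kappa>\<in>K. if ?x \<kappa> = v then Poly_Mapping.single (?m - xvar v) 1 * F v else 0)"
    using K by (intro sum.cong refl) (simp add: lookup_edges sum.If_cases Int_def mult.assoc)
  also have "\<dots> = (\<Sum>\<kappa>\<in>K. \<Sum>v\<in>basis L N. if ?x \<kappa> = v then Poly_Mapping.single (?m - xvar v) 1 * F v else 0)"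
    by (rule sum.swap)
  also have "\<dots> = (\<Sum>\<kappa>\<in>K. Poly_Mapping.single (edges (K - {\<kappa>}) r c w) 1 * F (?x \<kappa>))"
  proof (rule sum.cong[OF refl])
    fix \<kappa> assume k: "\<kappa> \<in> K"
    have "?m - xvar (?x \<kappa>) = edges (K - {\<kappa>}) r c w"
      by (simp add: edges_remove[OF K k])
    then show "(\<Sum>v\<in>basis L N. if ?x \<kappa> = v then Poly_Mapping.single (?m - xvar v) 1 * F v else 0)
        = Poly_Mapping.single (edges (K - {\<kappa>}) r c w) 1 * F (?x \<kappa>)"
      using E[OF k] by (simp add: sum.delta')
  qed
  also have "\<dots> = (\<Sum>\<kappa>\<in>K. (\<Sum>s=1..N. Const (X s (r \<kappa>)) * Poly_Mapping.single (edges K (r(\<kappa> := s)) c w) 1) -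
      (\<Sum>s=1..N. Const (X (c \<kappa>) s) * Poly_Mapping.single (edges K r (c(\<kappa> := s)) w) 1))"
  proof (rule sum.cong[OF refl])
    fix \<kappa> assume k: "\<kappa> \<in> K"
    have r: "edges (K - {\<kappa>}) (r(\<kappa> := s)) c w = edges (K - {\<kappa>}) r c w" for s
      by (rule edges_cong) auto
    have c: "edges (K - {\<kappa>}) r (c(\<kappa> := s)) w = edges (K - {\<kappa>}) r c w" for s
      by (rule edges_cong) auto
    have V: "Poly_Mapping.single m0 1 * (Const z * Var u) = Const z * Poly_Mapping.single (m0 + xvar u) 1"
      for m0 z and u :: mvar
      by (simp add: Const_def Var_single mult_single)
    show "Poly_Mapping.single (edges (K - {\<kappa>}) r c w) 1 * F (?x \<kappa>) =
      (\<Sum>s=1..N. Const (X s (r \<kappa>)) * Poly_Mapping.single (edges K (r(\<kappa> := s)) c w) 1) -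
      (\<Sum>s=1..N. Const (X (c \<kappa>) s) * Poly_Mapping.single (edges K r (c(\<kappa> := s)) w) 1)"
      by (simp add: F_def right_diff_distrib sum_distrib_left V edges_remove[OF K k] r c)
  qed
  finally show ?thesis by (simp add: sum_subtractf)
qed

text \<open>
  The term where \<open>X\<close> acts on the source of the edge after \<open>\<kappa>\<close> cancels the one where it acts on the target of \<open>\<kappa>\<close>:
  the two differ by exchanging the names of the vertex at which both edges meet and of the summation index
  introduced by \<open>X\<close>.
\<close>

lemma labelled_trace_invariant:
  assumes K: "finite K" and \<sigma>: "bij_betw \<sigma> K K" and w: "w ` K \<subseteq> {1..L}"
  shows "ad L N (diag X) (labelled_trace K \<sigma> w N) = 0"
proof -
  let ?A = "K \<rightarrow>\<^sub>E {1..N}" and ?T = "\<lambda>r c. Poly_Mapping.single (edges K r c w) 1 :: mvar mpol"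
  define R where "R \<kappa> a s = Const (X s (a \<kappa>)) * ?T (a(\<kappa> := s)) (a \<circ> \<sigma>)" for \<kappa> a s
  define C where "C \<kappa> a s = Const (X (a (\<sigma> \<kappa>)) s) * ?T a ((a \<circ> \<sigma>)(\<kappa> := s))" for \<kappa> a s
  have \<sigma>K: "\<sigma> \<kappa> \<in> K" if "\<kappa> \<in> K" for \<kappa> using \<sigma> that by (rule bij_betw_apply)
  have swap: "(\<Sum>(a, s)\<in>?A \<times> {1..N}. R (\<sigma> \<kappa>) a s) = (\<Sum>(a, s)\<in>?A \<times> {1..N}. C \<kappa> a s)"
    if k: "\<kappa> \<in> K" for \<kappa>
  proof -
    \<comment> \<open>An involution: exchange the vertex at which \<open>\<kappa>\<close> ends with the summation index.\<close>
    let ?g = "\<lambda>(a, s). (a(\<sigma> \<kappa> := s), a (\<sigma> \<kappa>))"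
    show ?thesis
    proof (rule sum.reindex_bij_witness[where i = ?g and j = ?g])
      fix p assume "p \<in> ?A \<times> {1..N}"
      then obtain a s where p: "p = (a, s)" "a \<in> ?A" "s \<in> {1..N}" by auto
      show "?g (?g p) = p" by (simp add: p)
      show "?g p \<in> ?A \<times> {1..N}" using p \<sigma>K[OF k] by (auto simp: PiE_iff extensional_def)
      have "edges K (a(\<sigma> \<kappa> := s)) ((a(\<sigma> \<kappa> := s) \<circ> \<sigma>)(\<kappa> := a (\<sigma> \<kappa>))) w =
          edges K (a(\<sigma> \<kappa> := s)) (a \<circ> \<sigma>) w"
      proof (rule edges_cong)
        fix \<kappa>' assume "\<kappa>' \<in> K"
        then have "\<sigma> \<kappa>' = \<sigma> \<kappa> \<longleftrightarrow> \<kappa>' = \<kappa>" using \<sigma> k by (auto simp: bij_betw_def inj_on_eq_iff)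
        then show "((a(\<sigma> \<kappa> := s) \<circ> \<sigma>)(\<kappa> := a (\<sigma> \<kappa>))) \<kappa>' = (a \<circ> \<sigma>) \<kappa>'" by simp
      qed auto
      then show "(case ?g p of (a, s) \<Rightarrow> C \<kappa> a s) = (case p of (a, s) \<Rightarrow> R (\<sigma> \<kappa>) a s)"
        by (simp add: p C_def R_def)
    qed (use \<sigma>K[OF k] in \<open>auto simp: PiE_iff extensional_def\<close>)
  qed
  have "ad L N (diag X) (labelled_trace K \<sigma> w N) =
      (\<Sum>a\<in>?A. (\<Sum>\<kappa>\<in>K. \<Sum>s=1..N. R \<kappa> a s) - (\<Sum>\<kappa>\<in>K. \<Sum>s=1..N. C \<kappa> a s))"
    unfolding labelled_trace_def ad_sum
  proof (rule sum.cong[OF refl])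
    fix a assume "a \<in> ?A"
    then have "(a \<kappa>, (a \<circ> \<sigma>) \<kappa>, w \<kappa>) \<in> basis L N" if "\<kappa> \<in> K" for \<kappa>
      using that \<sigma>K[OF that] w by (auto simp: basis_def PiE_iff)
    then show "ad L N (diag X) (?T a (a \<circ> \<sigma>)) = (\<Sum>\<kappa>\<in>K. \<Sum>s=1..N. R \<kappa> a s) - (\<Sum>\<kappa>\<in>K. \<Sum>s=1..N. C \<kappa> a s)"
      by (subst ad_edges[OF K]) (simp_all add: R_def C_def)
  qed
  also have "\<dots> = (\<Sum>\<kappa>\<in>K. \<Sum>(a, s)\<in>?A \<times> {1..N}. R \<kappa> a s) - (\<Sum>\<kappa>\<in>K. \<Sum>(a, s)\<in>?A \<times> {1..N}. C \<kappa> a s)"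
    unfolding sum_subtractf sum.swap[of _ K ?A] sum.cartesian_product[symmetric] ..
  also have "(\<Sum>\<kappa>\<in>K. \<Sum>(a, s)\<in>?A \<times> {1..N}. R \<kappa> a s) = (\<Sum>\<kappa>\<in>K. \<Sum>(a, s)\<in>?A \<times> {1..N}. R (\<sigma> \<kappa>) a s)"
    by (rule sum.reindex_bij_betw[OF \<sigma>, symmetric])
  finally show ?thesis using swap by simp
qed

lemma labelled_trace_P_fin:
  assumes K: "finite K" and \<sigma>: "bij_betw \<sigma> K K" and w: "w ` K \<subseteq> {1..L}"
  shows "labelled_trace K \<sigma> w N \<in> P_fin d L N"
  using labelled_trace_invariant[OF assms] labelled_trace_Sym[OF K _ w, of \<sigma> N] \<sigma>
  by (auto simp: P_fin_def bij_betw_def)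

section \<open>The projection as restriction to fewer vertices\<close>

definition restrict_basis :: "nat \<Rightarrow> nat \<Rightarrow> mvar mpol \<Rightarrow> mvar mpol" where
  "restrict_basis L N f =
    (\<Sum>m\<in>{m \<in> supp f. supp m \<subseteq> basis L N}. Poly_Mapping.single m (lk f m))"

lemma lookup_restrict_basis:
  "lk (restrict_basis L N f) m = (if supp m \<subseteq> basis L N then lk f m else 0)"
proof -
  have "lk (restrict_basis L N f) m =
      (\<Sum>m'\<in>{m \<in> supp f. supp m \<subseteq> basis L N}. if m' = m then lk f m' else 0)"
    by (simp add: restrict_basis_def lookup_sum lookup_single when_def)
  also have "\<dots> = (if m \<in> {m \<in> supp f. supp m \<subseteq> basis L N} then lk f m else 0)"
    by (rule sum.delta) simp
  finally show ?thesis by (auto simp: in_keys_iff)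
qed

lemma restrict_labelled_trace:
  assumes K: "finite K" and \<sigma>: "\<sigma> ` K \<subseteq> K" and w: "w ` K \<subseteq> {1..L}"
  shows "restrict_basis L N (labelled_trace K \<sigma> w (Suc N)) = labelled_trace K \<sigma> w N"
proof (rule poly_mapping_eqI)
  fix m
  have *: "a \<in> K \<rightarrow>\<^sub>E {1..N} \<longleftrightarrow> a \<in> K \<rightarrow>\<^sub>E {1..Suc N} \<and> supp (edges K a (a \<circ> \<sigma>) w) \<subseteq> basis L N" for a
    unfolding supp_edges_basis[OF K \<sigma> w] by (auto simp: PiE_iff image_subset_iff)
  show "lk (restrict_basis L N (labelled_trace K \<sigma> w (Suc N))) m = lk (labelled_trace K \<sigma> w N) m"
  proof (cases "supp m \<subseteq> basis L N")
    case True
    then have "{a \<in> K \<rightarrow>\<^sub>E {1..N}. edges K a (a \<circ> \<sigma>) w = m} = {a \<in> K \<rightarrow>\<^sub>E {1..Suc N}. edges K a (a \<circ> \<sigma>) w = m}"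
      using * by auto
    then show ?thesis using True by (simp add: lookup_restrict_basis lookup_labelled_trace[OF K])
  next
    case False
    then have "{a \<in> K \<rightarrow>\<^sub>E {1..N}. edges K a (a \<circ> \<sigma>) w = m} = {}" using * by auto
    then have "lk (labelled_trace K \<sigma> w N) m = 0"
      unfolding lookup_labelled_trace[OF K] by (simp only: card.empty of_nat_0)
    then show ?thesis using False by (simp add: lookup_restrict_basis)
  qed
qed

lemma Sym_iff: "f \<in> Sym L N \<longleftrightarrow> (\<forall>m. lk f m \<noteq> 0 \<longrightarrow> supp m \<subseteq> basis L N)"
  by (auto simp: Sym_def polys_in_def in_keys_iff)

lemma Sym_zero: "0 \<in> Sym L N"
  by (simp add: Sym_iff)

lemma Sym_add: "f \<in> Sym L N \<Longrightarrow> g \<in> Sym L N \<Longrightarrow> f + g \<in> Sym L N"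
  unfolding Sym_iff lookup_add by (metis add.right_neutral)

lemma Sym_diff: "f \<in> Sym L N \<Longrightarrow> g \<in> Sym L N \<Longrightarrow> f - g \<in> Sym L N"
  unfolding Sym_iff lookup_minus by (metis diff_zero)

lemma I_plusI:
  assumes "\<And>i \<alpha>. h i \<alpha> \<in> Sym L N" "f = (\<Sum>i=1..N. \<Sum>\<alpha>=1..L. h i \<alpha> * Var (i, N, \<alpha>))"
  shows "f \<in> I_plus L N"
  unfolding I_plus_def using assms by (intro CollectI exI[of _ h]) simp

lemma I_plus_zero: "0 \<in> I_plus L N"
  by (rule I_plusI[of "\<lambda>_ _. 0"]) (simp_all add: Sym_zero)

lemma I_plus_add:
  assumes "f \<in> I_plus L N" "g \<in> I_plus L N" shows "f + g \<in> I_plus L N"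
proof -
  obtain h k where "\<forall>i \<alpha>. h i \<alpha> \<in> Sym L N" "f = (\<Sum>i=1..N. \<Sum>\<alpha>=1..L. h i \<alpha> * Var (i, N, \<alpha>))"
    "\<forall>i \<alpha>. k i \<alpha> \<in> Sym L N" "g = (\<Sum>i=1..N. \<Sum>\<alpha>=1..L. k i \<alpha> * Var (i, N, \<alpha>))"
    using assms by (auto simp: I_plus_def)
  then show ?thesis
    by (intro I_plusI[of "\<lambda>i \<alpha>. h i \<alpha> + k i \<alpha>"]) (simp_all add: distrib_right sum.distrib Sym_add)
qed

lemma I_plus_sum: "(\<And>x. x \<in> A \<Longrightarrow> g x \<in> I_plus L N) \<Longrightarrow> sum g A \<in> I_plus L N"
  by (induction A rule: infinite_finite_induct) (auto simp: I_plus_zero I_plus_add)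

lemma single_in_I_plus:
  assumes m: "supp m \<subseteq> basis L N" and x: "(i, N, \<alpha>) \<in> supp m"
  shows "Poly_Mapping.single m c \<in> I_plus L N"
proof -
  define m0 where "m0 = m - xvar (i, N, \<alpha>)"
  have m0: "m = m0 + xvar (i, N, \<alpha>)"
    using minus_xvar_eq_iff[of m "(i, N, \<alpha>)" m0] x by (simp add: m0_def in_keys_iff)
  have "supp m0 \<subseteq> supp m" by (auto simp: m0 in_keys_iff lookup_add)
  then have S: "Poly_Mapping.single m0 c \<in> Sym L N"
    using m by (auto simp: Sym_iff lookup_single when_def)
  have i: "i \<in> {1..N}" "\<alpha> \<in> {1..L}" using m x by (auto simp: basis_def)
  let ?h = "\<lambda>j \<beta>. if j = i \<and> \<beta> = \<alpha> then Poly_Mapping.single m0 c else 0"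
  have "(\<Sum>j=1..N. \<Sum>\<beta>=1..L. ?h j \<beta> * Var (j, N, \<beta>)) =
    (\<Sum>j=1..N. if j = i then (\<Sum>\<beta>=1..L. if \<beta> = \<alpha> then Poly_Mapping.single m0 c * Var (i, N, \<alpha>) else 0) else 0)"
  proof (rule sum.cong[OF refl])
    fix j
    show "(\<Sum>\<beta>=1..L. ?h j \<beta> * Var (j, N, \<beta>)) =
      (if j = i then (\<Sum>\<beta>=1..L. if \<beta> = \<alpha> then Poly_Mapping.single m0 c * Var (i, N, \<alpha>) else 0) else 0)"
    proof (cases "j = i")
      case True
      have "(\<Sum>\<beta>=1..L. ?h j \<beta> * Var (j, N, \<beta>)) =
          (\<Sum>\<beta>=1..L. if \<beta> = \<alpha> then Poly_Mapping.single m0 c * Var (i, N, \<alpha>) else 0)"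
        by (rule sum.cong) (auto simp: True)
      then show ?thesis using True by simp
    qed simp
  qed
  also have "\<dots> = Poly_Mapping.single m0 c * Var (i, N, \<alpha>)" using i by (simp add: sum.delta)
  also have "\<dots> = Poly_Mapping.single m c" by (simp add: Var_single mult_single m0)
  finally show ?thesis using S Sym_zero by (intro I_plusI[of ?h]) simp_all
qed

lemma I_plus_supp:
  assumes "f \<in> I_plus L N" "m \<in> supp f"
  shows "\<exists>i \<alpha>. (i, N, \<alpha>) \<in> supp m"
proof -
  obtain h where f: "f = (\<Sum>i=1..N. \<Sum>\<alpha>=1..L. h i \<alpha> * Var (i, N, \<alpha>))"
    using assms(1) by (auto simp: I_plus_def)
  then have "(\<Sum>i=1..N. \<Sum>\<alpha>=1..L. lk (h i \<alpha> * Var (i, N, \<alpha>)) m) \<noteq> 0"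
    using assms(2) by (simp add: in_keys_iff lookup_sum)
  then obtain i where "(\<Sum>\<alpha>=1..L. lk (h i \<alpha> * Var (i, N, \<alpha>)) m) \<noteq> 0"
    by (rule sum.not_neutral_contains_not_neutral)
  then obtain \<alpha> where "lk (h i \<alpha> * Var (i, N, \<alpha>)) m \<noteq> 0"
    by (rule sum.not_neutral_contains_not_neutral)
  then have "lk m (i, N, \<alpha>) > 0" by (simp add: lookup_times_Var split: if_splits)
  then show ?thesis by (auto simp: in_keys_iff)
qed

lemma restrict_basis_Sym: "restrict_basis L N f \<in> Sym L N"
  by (simp add: Sym_iff lookup_restrict_basis)

lemma basis_mono: "N \<le> M \<Longrightarrow> basis L N \<subseteq> basis L M"
  by (auto simp: basis_def)

lemma Sym_mono: "N \<le> M \<Longrightarrow> Sym L N \<subseteq> Sym L M"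
  by (meson Sym_iff basis_mono order_trans subsetI)

text \<open>
  A monomial outside the smaller polynomial ring has an edge at the vertex \<open>Suc N\<close>, and by balancedness also
  one ending there; it therefore lies in the ideal. The restriction is invariant under the matrix unit at
  \<open>Suc N\<close>, as this vertex does not occur in it. Uniqueness holds because every monomial in an element of the ideal
  involves \<open>Suc N\<close>.
\<close>

lemma proj_eq_restrict_basis:
  assumes f: "f \<in> P_fin 0 L (Suc N)"
  shows "proj L (Suc N) f = restrict_basis L N f"
proof -
  let ?g = "restrict_basis L N f"
  have S: "f - ?g \<in> Sym L (Suc N)"
    using f restrict_basis_Sym[of L N f] Sym_mono[of N "Suc N" L] by (auto simp: P_fin_def intro!: Sym_diff)
  have "ad L (Suc N) (diag X) (f - ?g) = 0" if X: "X \<in> gl N (Suc N)" for X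
  proof -
    have X0: "X i j = 0" if "i \<noteq> Suc N \<or> j \<noteq> Suc N" for i j
      using X that by (force simp: gl_def)
    have "X \<in> gl 0 (Suc N)" using X by (auto simp: gl_def)
    then have "ad L (Suc N) (diag X) f = 0" using f by (simp add: P_fin_def)
    moreover have "ad L (Suc N) (diag X) ?g = 0"
    proof -
      have "partial (i, j, \<alpha>) ?g * ((\<Sum>s=1..Suc N. Const (X s i) * Var (s, j, \<alpha>)) -
          (\<Sum>s=1..Suc N. Const (X j s) * Var (i, s, \<alpha>))) = 0" for i j \<alpha>
      proof (cases "i = Suc N \<or> j = Suc N")
        case True
        have "partial (i, j, \<alpha>) ?g = 0"
        proof (rule poly_mapping_eqI)
          fix m
          have "(i, j, \<alpha>) \<in> supp (m + xvar (i, j, \<alpha>))"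
            by (simp add: in_keys_iff lookup_add lookup_xvar)
          then have "\<not> supp (m + xvar (i, j, \<alpha>)) \<subseteq> basis L N"
            using True by (auto simp: basis_def)
          then show "lk (partial (i, j, \<alpha>) ?g) m = lk 0 m"
            by (simp add: lookup_partial lookup_restrict_basis)
        qed
        then show ?thesis by simp
      qed (simp add: X0)
      then show ?thesis by (simp add: ad_diag case_prod_unfold)
    qed
    ultimately show ?thesis by (simp add: ad_diff)
  qed
  then have P: "f - ?g \<in> P_fin N L (Suc N)" using S by (simp add: P_fin_def)
  have I: "f - ?g \<in> I_plus L (Suc N)"
  proof -
    have "Poly_Mapping.single m (lk (f - ?g) m) \<in> I_plus L (Suc N)" if "m \<in> supp (f - ?g)" for m
    proof -
      have m: "lk f m \<noteq> 0" "\<not> supp m \<subseteq> basis L N"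
        using that by (auto simp: in_keys_iff lookup_minus lookup_restrict_basis split: if_splits)
      have supp: "supp m \<subseteq> basis L (Suc N)" by (rule P_fin_supp[OF f m(1)])
      obtain i j \<alpha> where x: "(i, j, \<alpha>) \<in> supp m" "i = Suc N \<or> j = Suc N"
        using m(2) supp by (fastforce simp: basis_def)
      have "cdeg L (Suc N) m (Suc N) > 0"
      proof (cases "j = Suc N")
        case True
        then show ?thesis using lookup_le_cdeg[OF supp, of "{(i, j, \<alpha>)}" "Suc N"] x by (simp add: in_keys_iff)
      next
        case False
        then show ?thesis
          using lookup_le_rdeg[OF supp, of "{(i, j, \<alpha>)}" "Suc N"] x invariant_balanced[OF f m(1), of "Suc N"]
          by (simp add: in_keys_iff)
      qed
      then have "cdeg L (Suc N) m (Suc N) \<noteq> 0" by simp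
      then obtain b \<beta> where "lk m (b, Suc N, \<beta>) \<noteq> 0"
        unfolding cdeg_def by (rule sum.not_neutral_contains_not_neutral) auto
      then show ?thesis by (intro single_in_I_plus[OF supp, of b \<beta>]) (simp add: in_keys_iff)
    qed
    then show ?thesis by (subst sum_single_lookup[symmetric]) (rule I_plus_sum)
  qed
  show ?thesis unfolding proj_def
  proof (rule the_equality)
    show "?g \<in> Sym L (Suc N - 1) \<and> f - ?g \<in> P_fin (Suc N - 1) L (Suc N) \<inter> I_plus L (Suc N)"
      using P I restrict_basis_Sym by simp
  next
    fix g assume "g \<in> Sym L (Suc N - 1) \<and> f - g \<in> P_fin (Suc N - 1) L (Suc N) \<inter> I_plus L (Suc N)"
    then have g: "g \<in> Sym L N" "f - g \<in> I_plus L (Suc N)" by auto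
    show "g = ?g"
    proof (rule poly_mapping_eqI)
      fix m
      show "lk g m = lk ?g m"
      proof (cases "supp m \<subseteq> basis L N")
        case True
        then have "(i, Suc N, \<alpha>) \<notin> supp m" for i \<alpha> by (auto simp: basis_def)
        then have "m \<notin> supp (f - g)" using I_plus_supp[OF g(2)] by blast
        then show ?thesis using True by (simp add: in_keys_iff lookup_minus lookup_restrict_basis)
      next
        case False
        then have "lk g m = 0" using g(1) by (auto simp: Sym_def polys_in_def in_keys_iff)
        then show ?thesis using False by (simp add: lookup_restrict_basis)
      qed
    qed
  qed
qed

section \<open>Products of the generators\<close>

definition word_trace :: "'j set \<Rightarrow> ('j \<Rightarrow> nat list) \<Rightarrow> nat \<Rightarrow> mvar mpol" where
  "word_trace J W N = labelled_trace (slots J W) (next_slot W) (letter W) N"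

lemma prod_single_one:
  "(\<Prod>x\<in>A. Poly_Mapping.single (g x) (1 :: complex)) = Poly_Mapping.single (\<Sum>x\<in>A. g x) 1"
  by (induction A rule: infinite_finite_induct) (simp_all add: mult_single)

text \<open>
  Expanding the product, a choice of one closed walk for each word is the same as a placement of all slots.
\<close>

lemma prod_p_word:
  assumes J: "finite J"
  shows "(\<Prod>j\<in>J. p_word (W j) N) = word_trace J W N"
proof -
  let ?B = "\<lambda>j. {l. length l = length (W j) \<and> set l \<subseteq> {1..N}}"
  let ?x = "\<lambda>l j k. (l ! k, l ! (Suc k mod length (W j)), W j ! k)"
  let ?i = "\<lambda>a. \<lambda>j\<in>J. map (\<lambda>k. a (j, k)) [0..<length (W j)]"
  let ?j = "\<lambda>g. \<lambda>\<kappa>\<in>slots J W. g (fst \<kappa>) ! snd \<kappa>"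
  have finB: "finite (?B j)" for j
    by (rule finite_subset[OF _ finite_lists_length_eq[of "{1..N}" "length (W j)"]]) auto
  have "p_word (W j) N = (\<Sum>l\<in>?B j. Poly_Mapping.single (\<Sum>k<length (W j). xvar (?x l j k)) 1)" for j
    unfolding p_word_def by (intro sum.cong refl) (simp add: Var_single prod_single_one)
  then have "(\<Prod>j\<in>J. p_word (W j) N) =
      (\<Prod>j\<in>J. \<Sum>l\<in>?B j. Poly_Mapping.single (\<Sum>k<length (W j). xvar (?x l j k)) 1)" by simp
  also have "\<dots> = (\<Sum>g\<in>PiE J ?B. \<Prod>j\<in>J. Poly_Mapping.single (\<Sum>k<length (W j). xvar (?x (g j) j k)) 1)"
    using J finB by (rule prod_sum_PiE)
  also have "\<dots> = (\<Sum>g\<in>PiE J ?B. Poly_Mapping.single (\<Sum>j\<in>J. \<Sum>k<length (W j). xvar (?x (g j) j k)) 1)"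
    by (simp add: prod_single_one)
  also have "\<dots> = word_trace J W N"
    unfolding word_trace_def labelled_trace_def
  proof (rule sum.reindex_bij_witness[where i = ?i and j = ?j])
    fix g assume g: "g \<in> PiE J ?B"
    then have len: "length (g j) = length (W j)" if "j \<in> J" for j using that by auto
    show "?j g \<in> slots J W \<rightarrow>\<^sub>E {1..N}"
    proof (rule PiE_I)
      fix \<kappa> assume "\<kappa> \<in> slots J W"
      then show "?j g \<kappa> \<in> {1..N}"
        using g nth_mem[of "snd \<kappa>" "g (fst \<kappa>)"] by (fastforce simp: slots_def PiE_iff)
    qed auto
    show "?i (?j g) = g"
    proof (rule ext)
      fix j show "?i (?j g) j = g j"
        using g len[of j] by (cases "j \<in> J") (auto intro!: nth_equalityI simp: slots_def PiE_iff extensional_def)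
    qed
    have "edges (slots J W) (?j g) (?j g \<circ> next_slot W) (letter W) =
        (\<Sum>(j, k)\<in>slots J W. xvar (?x (g j) j k))"
      unfolding edges_def
    proof (rule sum.cong[OF refl])
      fix \<kappa> assume k: "\<kappa> \<in> slots J W"
      obtain j l where "\<kappa> = (j, l)" by (metis surj_pair)
      with k bij_betw_apply[OF bij_next_slot[OF J] k]
      show "xvar (?j g \<kappa>, (?j g \<circ> next_slot W) \<kappa>, letter W \<kappa>) = (case \<kappa> of (j, k) \<Rightarrow> xvar (?x (g j) j k))"
        by (simp add: next_slot_def letter_def)
    qed
    also have "\<dots> = (\<Sum>j\<in>J. \<Sum>k<length (W j). xvar (?x (g j) j k))"
      unfolding slots_def using J by (subst sum.Sigma) auto
    finally show "Poly_Mapping.single (edges (slots J W) (?j g) (?j g \<circ> next_slot W) (letter W)) 1 =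
      Poly_Mapping.single (\<Sum>j\<in>J. \<Sum>k<length (W j). xvar (?x (g j) j k)) (1 :: complex)" by simp
  next
    fix a assume a: "a \<in> slots J W \<rightarrow>\<^sub>E {1..N}"
    show "?i a \<in> PiE J ?B"
      using a by (auto simp: slots_def PiE_iff)
    show "?j (?i a) = a"
    proof (rule ext)
      fix \<kappa> show "?j (?i a) \<kappa> = a \<kappa>"
        using a by (cases "\<kappa> \<in> slots J W"; cases \<kappa>) (auto simp: slots_def PiE_iff extensional_def)
    qed
  qed
  finally show ?thesis .
qed

lemma lookup_word_trace_nonzero:
  assumes "finite J"
  shows "lk (word_trace J W N) m \<noteq> 0 \<longleftrightarrow> (\<exists>a \<in> slots J W \<rightarrow>\<^sub>E {1..N}. cycles_mon J W a = m)"
  unfolding word_trace_def cycles_mon_def using assms by (intro lookup_labelled_trace_nonzero) simp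

definition mono_eval :: "(nat list set \<Rightarrow>\<^sub>0 nat) \<Rightarrow> nat \<Rightarrow> mvar mpol" where
  "mono_eval M N = (\<Prod>c\<in>supp M. p_circ c N ^ lk M c)"

lemma mono_eval_word_type:
  assumes J: "finite J" and W: "W ` J \<subseteq> words L"
  shows "mono_eval (word_type L J W) N = word_trace J W N"
proof -
  let ?M = "word_type L J W"
  have sub: "(\<lambda>j. circ L (W j)) ` J \<subseteq> supp ?M"
    using J by (auto simp: in_keys_iff lookup_word_type card_eq_0_iff)
  have "mono_eval ?M N = (\<Prod>c\<in>supp ?M. \<Prod>j\<in>{j \<in> J. circ L (W j) = c}. p_circ (circ L (W j)) N)"
    unfolding mono_eval_def lookup_word_type[OF J] by (intro prod.cong refl) simp
  also have "\<dots> = (\<Prod>j\<in>J. p_circ (circ L (W j)) N)"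
    by (rule prod.group[OF J _ sub]) simp
  also have "\<dots> = (\<Prod>j\<in>J. p_word (W j) N)"
    using W by (intro prod.cong refl) (simp add: p_circ_circ image_subset_iff)
  finally show ?thesis by (simp add: prod_p_word[OF J])
qed

definition rep_word :: "nat \<Rightarrow> nat list set \<Rightarrow> nat list" where
  "rep_word L c = (SOME w. w \<in> words L \<and> circ L w = c)"

lemma rep_word:
  assumes "c \<in> circular_words L"
  shows "rep_word L c \<in> words L" "circ L (rep_word L c) = c"
proof -
  have "\<exists>w. w \<in> words L \<and> circ L w = c" using assms by (elim circ_rep) auto
  then have "rep_word L c \<in> words L \<and> circ L (rep_word L c) = c"
    unfolding rep_word_def by (rule someI_ex)
  then show "rep_word L c \<in> words L" "circ L (rep_word L c) = c" by auto
qed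

text \<open>
  One family of words realising a given monomial \<open>M\<close>: the chosen representative of \<open>c\<close>, repeated as often as the
  exponent of \<open>c\<close> says.
\<close>

definition cycle_indices :: "(nat list set \<Rightarrow>\<^sub>0 nat) \<Rightarrow> (nat list set \<times> nat) set" where
  "cycle_indices M = (SIGMA c:supp M. {..<lk M c})"

definition cycle_words :: "nat \<Rightarrow> nat list set \<times> nat \<Rightarrow> nat list" where
  "cycle_words L = (\<lambda>(c, t). rep_word L c)"

abbreviation cycle_slots :: "nat \<Rightarrow> (nat list set \<Rightarrow>\<^sub>0 nat) \<Rightarrow> ((nat list set \<times> nat) \<times> nat) set" where
  "cycle_slots L M \<equiv> slots (cycle_indices M) (cycle_words L)"

text \<open>
  Slots are edges of the graph, so this is the degree of \<open>mono_eval M N\<close>.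
\<close>

definition weight :: "nat \<Rightarrow> (nat list set \<Rightarrow>\<^sub>0 nat) \<Rightarrow> nat" where
  "weight L M = card (cycle_slots L M)"

definition canonical_indices :: "nat \<Rightarrow> (nat list set \<Rightarrow>\<^sub>0 nat) \<Rightarrow> (nat list set \<times> nat) \<times> nat \<Rightarrow> nat" where
  "canonical_indices L M = (SOME a. bij_betw a (cycle_slots L M) {1..weight L M})"

text \<open>
  A fixed injective placement of type \<open>M\<close>; it uses the least possible vertices, so that it is visible at every level from \<open>weight L M\<close> on.
\<close>

definition canonical_mon :: "nat \<Rightarrow> (nat list set \<Rightarrow>\<^sub>0 nat) \<Rightarrow> mvar \<Rightarrow>\<^sub>0 nat" where
  "canonical_mon L M = cycles_mon (cycle_indices M) (cycle_words L) (canonical_indices L M)"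

lemma finite_cycle_indices [simp]: "finite (cycle_indices M)"
  by (simp add: cycle_indices_def)

lemma bij_canonical_indices: "bij_betw (canonical_indices L M) (cycle_slots L M) {1..weight L M}"
proof -
  have "\<exists>a. bij_betw a (cycle_slots L M) {1..weight L M}"
    by (rule finite_same_card_bij) (simp_all add: weight_def)
  then show ?thesis unfolding canonical_indices_def by (rule someI_ex)
qed

lemma cycle_words_in:
  assumes "supp M \<subseteq> circular_words L"
  shows "cycle_words L ` cycle_indices M \<subseteq> words L"
  using assms rep_word(1)[of _ L] by (auto simp: cycle_words_def cycle_indices_def)

lemma word_type_cycle_words:
  assumes "supp M \<subseteq> circular_words L"
  shows "word_type L (cycle_indices M) (cycle_words L) = M"
proof (rule poly_mapping_eqI)
  fix d
  have "circ L (rep_word L c) = c" if "t < lk M c" for c t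
    using assms that by (intro rep_word(2)) (auto simp: in_keys_iff)
  then have "{j \<in> cycle_indices M. circ L (cycle_words L j) = d} = {d} \<times> {..<lk M d}"
    by (auto simp: cycle_words_def cycle_indices_def in_keys_iff)
  then show "lk (word_type L (cycle_indices M) (cycle_words L)) d = lk M d"
    by (simp add: lookup_word_type)
qed

lemma mono_eval_eq_word_trace:
  assumes "supp M \<subseteq> circular_words L"
  shows "mono_eval M N = word_trace (cycle_indices M) (cycle_words L) N"
  using mono_eval_word_type[OF finite_cycle_indices cycle_words_in[OF assms], of N]
  by (simp add: word_type_cycle_words[OF assms])

text \<open>
  The pairing of types with their canonical placements is diagonal with nonzero diagonal; both independence and
  the choice of coefficients in the proof of generation rest on this.
\<close>

lemma lookup_mono_eval_canonical_mon:
  assumes M: "supp M \<subseteq> circular_words L" and M': "supp M' \<subseteq> circular_words L"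
    and N: "weight L M' \<le> N"
  shows "lk (mono_eval M N) (canonical_mon L M') \<noteq> 0 \<longleftrightarrow> M = M'"
proof
  assume "lk (mono_eval M N) (canonical_mon L M') \<noteq> 0"
  then obtain a where "cycles_mon (cycle_indices M) (cycle_words L) a = canonical_mon L M'"
    unfolding mono_eval_eq_word_trace[OF M] by (subst (asm) lookup_word_trace_nonzero) auto
  then have "word_type L (cycle_indices M) (cycle_words L) = word_type L (cycle_indices M') (cycle_words L)"
    unfolding canonical_mon_def using bij_canonical_indices[of L M']
    by (intro cycles_mon_determines_type) (auto simp: cycle_words_in M M' bij_betw_def)
  then show "M = M'" by (simp add: word_type_cycle_words M M')
next
  assume "M = M'"
  define a where "a = restrict (canonical_indices L M') (cycle_slots L M')"
  have "a \<in> cycle_slots L M' \<rightarrow>\<^sub>E {1..N}"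
    using bij_betw_apply[OF bij_canonical_indices[of L M']] N by (force simp: a_def)
  moreover have "cycles_mon (cycle_indices M') (cycle_words L) a = canonical_mon L M'"
    unfolding canonical_mon_def cycles_mon_def
    using bij_betw_apply[OF bij_next_slot[OF finite_cycle_indices[of M'], of "cycle_words L"]]
    by (intro edges_cong) (auto simp: a_def)
  ultimately show "lk (mono_eval M N) (canonical_mon L M') \<noteq> 0"
    unfolding \<open>M = M'\<close> mono_eval_eq_word_trace[OF M'] by (subst lookup_word_trace_nonzero) auto
qed

lemma canonical_mon_inject:
  assumes M: "supp M \<subseteq> circular_words L" and M': "supp M' \<subseteq> circular_words L"
    and eq: "canonical_mon L M = canonical_mon L M'"
  shows "M = M'"
proof -
  let ?N = "max (weight L M) (weight L M')"
  have "lk (mono_eval M ?N) (canonical_mon L M) \<noteq> 0"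
    using lookup_mono_eval_canonical_mon[OF M M, of ?N] by simp
  then show ?thesis unfolding eq using lookup_mono_eval_canonical_mon[OF M M', of ?N] by simp
qed

section \<open>Evaluation at the generators\<close>

lemma lookup_Const_times: "lk (Const c * f) m = c * lk f m"
proof -
  have "Const c * f = (\<Sum>k\<in>supp f. Poly_Mapping.single k (c * lk f k))"
    by (subst sum_single_lookup[of f, symmetric]) (simp add: sum_distrib_left Const_def mult_single)
  then have "lk (Const c * f) m = (\<Sum>k\<in>supp f. if k = m then c * lk f k else 0)"
    by (simp add: lookup_sum lookup_single when_def)
  then show ?thesis by (simp add: sum.delta in_keys_iff)
qed

lemma sum_fun_apply: "(\<Sum>x\<in>A. f x) y = (\<Sum>x\<in>A. f x y)"
  for f :: "'a \<Rightarrow> 'b \<Rightarrow> 'c :: comm_monoid_add"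
  by (induction A rule: infinite_finite_induct) simp_all

lemma prod_fun_apply: "(\<Prod>x\<in>A. f x) y = (\<Prod>x\<in>A. f x y)"
  for f :: "'a \<Rightarrow> 'b \<Rightarrow> 'c :: comm_monoid_mult"
  by (induction A rule: infinite_finite_induct) simp_all

lemma power_fun_apply: "(f ^ n) y = f y ^ n"
  for f :: "'b \<Rightarrow> 'c :: monoid_mult"
  by (induction n) simp_all

definition eval_term :: "complex \<Rightarrow> (nat list set \<Rightarrow>\<^sub>0 nat) \<Rightarrow> nat \<Rightarrow> mvar mpol" where
  "eval_term z M = (\<lambda>N. Const z * mono_eval M N)"

abbreviation eval_circ :: "nat list set mpol \<Rightarrow> nat \<Rightarrow> mvar mpol" where
  "eval_circ \<equiv> poly_eval seq_const p_circ"

text \<open>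
  Additivity needs a common index set for the monomials of two polynomials and of their sum.
\<close>

lemma eval_circ_superset:
  assumes "finite A" "supp q \<subseteq> A"
  shows "eval_circ q = (\<Sum>M\<in>A. eval_term (lk q M) M)"
proof -
  have "eval_circ q = (\<Sum>M\<in>supp q. eval_term (lk q M) M)"
    unfolding poly_eval_def
  proof (rule sum.cong[OF refl])
    fix M show "seq_const (lk q M) * (\<Prod>x\<in>supp M. p_circ x ^ lk M x) = eval_term (lk q M) M"
      by (rule ext) (simp add: eval_term_def mono_eval_def seq_const_def prod_fun_apply power_fun_apply)
  qed
  also have "\<dots> = (\<Sum>M\<in>A. eval_term (lk q M) M)"
    using assms by (intro sum.mono_neutral_left) (auto simp: eval_term_def in_keys_iff fun_eq_iff)
  finally show ?thesis .
qed

lemma eval_circ_add: "eval_circ (p + q) = eval_circ p + eval_circ q"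
proof -
  let ?A = "supp p \<union> supp q"
  have "eval_circ (p + q) = (\<Sum>M\<in>?A. eval_term (lk (p + q) M) M)"
    by (rule eval_circ_superset) (auto simp: keys_add)
  also have "\<dots> = (\<Sum>M\<in>?A. eval_term (lk p M) M) + (\<Sum>M\<in>?A. eval_term (lk q M) M)"
    unfolding sum.distrib[symmetric]
    by (intro sum.cong refl) (simp add: eval_term_def fun_eq_iff lookup_add Const_def single_add distrib_right)
  also have "\<dots> = eval_circ p + eval_circ q"
    by (subst (1 2) eval_circ_superset[of ?A]) auto
  finally show ?thesis .
qed

lemma eval_circ_zero: "eval_circ 0 = 0"
  by (simp add: poly_eval_def)

lemma eval_circ_sum: "eval_circ (sum g A) = (\<Sum>x\<in>A. eval_circ (g x))"
  by (induction A rule: infinite_finite_induct) (simp_all add: eval_circ_add eval_circ_zero)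

lemma eval_circ_diff: "eval_circ (p - q) = eval_circ p - eval_circ q"
  using eval_circ_add[of "p - q" q] by (simp add: algebra_simps)

lemma polys_in_iff: "q \<in> polys_in X \<longleftrightarrow> (\<forall>M. lk q M \<noteq> 0 \<longrightarrow> supp M \<subseteq> X)"
  by (auto simp: polys_in_def in_keys_iff)

lemma lookup_eval_circ_canonical_mon:
  assumes q: "q \<in> polys_in (circular_words L)" and M: "supp M \<subseteq> circular_words L"
    and N: "weight L M \<le> N"
  shows "lk (eval_circ q N) (canonical_mon L M) = lk q M * lk (mono_eval M N) (canonical_mon L M)"
proof -
  have "lk (eval_circ q N) (canonical_mon L M) =
      (\<Sum>M'\<in>supp q. lk q M' * lk (mono_eval M' N) (canonical_mon L M))"
    by (simp add: eval_circ_superset[OF finite_keys subset_refl] sum_fun_apply lookup_sum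
        eval_term_def lookup_Const_times)
  also have "\<dots> = (\<Sum>M'\<in>supp q. if M' = M then lk q M * lk (mono_eval M N) (canonical_mon L M) else 0)"
  proof (rule sum.cong[OF refl])
    fix M' assume "M' \<in> supp q"
    then have "supp M' \<subseteq> circular_words L" using q by (auto simp: polys_in_def)
    from lookup_mono_eval_canonical_mon[OF this M N]
    show "lk q M' * lk (mono_eval M' N) (canonical_mon L M) =
      (if M' = M then lk q M * lk (mono_eval M N) (canonical_mon L M) else 0)" by auto
  qed
  also have "\<dots> = lk q M * lk (mono_eval M N) (canonical_mon L M)"
    by (simp add: sum.delta in_keys_iff)
  finally show ?thesis .
qed

lemma eval_circ_eq_0:
  assumes q: "q \<in> polys_in (circular_words L)" and z: "eval_circ q = 0"
  shows "q = 0"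
proof (rule poly_mapping_eqI)
  fix M
  have "lk q M = 0" if "lk q M \<noteq> 0"
  proof -
    have M: "supp M \<subseteq> circular_words L" using q that by (simp add: polys_in_iff)
    have "lk q M * lk (mono_eval M (weight L M)) (canonical_mon L M) = 0"
      using lookup_eval_circ_canonical_mon[OF q M order_refl] by (simp add: z)
    then show ?thesis using lookup_mono_eval_canonical_mon[OF M M order_refl] by simp
  qed
  then show "lk q M = lk 0 M" by auto
qed

section \<open>The projective limit\<close>

lemma P_lim_iff:
  "f \<in> P_lim L n \<longleftrightarrow> (\<forall>N. f N \<in> P_fin 0 L N \<and> homogeneous n (f N) \<and>
     restrict_basis L N (f (Suc N)) = f N)"
  unfolding P_lim_def using proj_eq_restrict_basis by auto

lemma homogeneous_iff: "homogeneous n f \<longleftrightarrow> (\<forall>m. lk f m \<noteq> 0 \<longrightarrow> mon_degree m = n)"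
  by (auto simp: homogeneous_def in_keys_iff)

lemma P_lim_zero: "0 \<in> P_lim L n"
  by (auto simp: P_lim_iff P_fin_def Sym_zero homogeneous_iff lookup_restrict_basis intro!: poly_mapping_eqI)

lemma P_lim_add:
  assumes "f \<in> P_lim L n" "g \<in> P_lim L n"
  shows "f + g \<in> P_lim L n"
proof -
  have "restrict_basis L N (f (Suc N) + g (Suc N)) = restrict_basis L N (f (Suc N)) + restrict_basis L N (g (Suc N))" for N
    by (intro poly_mapping_eqI) (simp add: lookup_restrict_basis lookup_add)
  moreover have "homogeneous n (f N + g N)" for N
    using assms unfolding P_lim_iff homogeneous_iff lookup_add by (metis add.right_neutral)
  ultimately show ?thesis using assms by (simp add: P_lim_iff P_fin_def Sym_add ad_add)
qed

lemma ad_Const_times: "ad L N A (Const z * f) = Const z * ad L N A f"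
proof -
  have "partial v (Const z * f) = Const z * partial v f" for v
    by (intro poly_mapping_eqI) (simp add: lookup_partial lookup_Const_times)
  then show ?thesis by (simp add: ad_def sum_distrib_left mult.assoc)
qed

lemma P_lim_scale:
  assumes "f \<in> P_lim L n"
  shows "(\<lambda>N. Const z * f N) \<in> P_lim L n"
proof -
  have "restrict_basis L N (Const z * f (Suc N)) = Const z * restrict_basis L N (f (Suc N))" for N
    by (intro poly_mapping_eqI) (simp add: lookup_restrict_basis lookup_Const_times)
  then show ?thesis using assms
    by (auto simp: P_lim_iff P_fin_def Sym_iff ad_Const_times homogeneous_iff lookup_Const_times)
qed

lemma P_lim_sum: "(\<And>x. x \<in> A \<Longrightarrow> g x \<in> P_lim L n) \<Longrightarrow> sum g A \<in> P_lim L n"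
  by (induction A rule: infinite_finite_induct) (auto simp: P_lim_zero P_lim_add)

lemma P_lim_diff:
  assumes "f \<in> P_lim L n" "g \<in> P_lim L n"
  shows "f - g \<in> P_lim L n"
proof -
  have eq: "f - g = f + (\<lambda>N. Const (- 1) * g N)"
    by (rule ext) (simp add: Const_def single_uminus)
  show ?thesis unfolding eq by (rule P_lim_add[OF assms(1) P_lim_scale[OF assms(2)]])
qed

lemma word_trace_P_lim:
  assumes J: "finite J" and W: "W ` J \<subseteq> words L"
  shows "word_trace J W \<in> P_lim L (card (slots J W))"
proof -
  have K: "finite (slots J W)" using J by simp
  note \<sigma> = bij_next_slot[OF J, of W] and w = letter_range[OF W]
  have s: "next_slot W ` slots J W \<subseteq> slots J W" using \<sigma> by (simp add: bij_betw_def)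
  show ?thesis
    unfolding P_lim_iff word_trace_def
    using labelled_trace_P_fin[OF K \<sigma> w] labelled_trace_homogeneous[OF K] restrict_labelled_trace[OF K s w]
    by blast
qed

lemma eval_term_P_lim:
  assumes "supp M \<subseteq> circular_words L"
  shows "eval_term z M \<in> P_lim L (weight L M)"
  using P_lim_scale[OF word_trace_P_lim[OF finite_cycle_indices cycle_words_in[OF assms]], of z]
  by (simp add: eval_term_def mono_eval_eq_word_trace[OF assms] weight_def)

lemma p_circ_P_lim:
  assumes "c \<in> circular_words L"
  shows "p_circ c \<in> P_lim L (circ_length c)"
proof -
  obtain w where w: "w \<in> words L" "c = circ L w" using assms by (rule circ_rep)
  have "word_trace {()} (\<lambda>_. w) = p_circ c"
    using prod_p_word[of "{()}" "\<lambda>_. w"] w by (simp add: fun_eq_iff p_circ_circ)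
  moreover have "card (slots {()} (\<lambda>_. w)) = circ_length c"
    using w by (simp add: slots_def circ_length_circ)
  ultimately show ?thesis using word_trace_P_lim[of "{()}" "\<lambda>_. w" L] w by simp
qed

lemma eval_circ_graded_sum:
  assumes q: "q \<in> polys_in (circular_words L)"
  shows "eval_circ q \<in> graded_sum (P_lim L)"
proof -
  define h where "h n = (\<Sum>M\<in>{M \<in> supp q. weight L M = n}. eval_term (lk q M) M)" for n
  define D where "D = (\<Sum>M\<in>supp q. weight L M)"
  have "h n \<in> P_lim L n" for n
    unfolding h_def
  proof (rule P_lim_sum)
    fix M assume "M \<in> {M \<in> supp q. weight L M = n}"
    then show "eval_term (lk q M) M \<in> P_lim L n"
      using q eval_term_P_lim[of M L] by (auto simp: polys_in_def)
  qed
  moreover have "eval_circ q = (\<Sum>n\<le>D. h n)"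
  proof -
    have "weight L ` supp q \<subseteq> {..D}"
      by (auto simp: D_def intro: member_le_sum)
    then show ?thesis
      unfolding h_def eval_circ_superset[OF finite_keys subset_refl]
      by (intro sum.group[symmetric]) auto
  qed
  ultimately show ?thesis unfolding graded_sum_def by blast
qed

lemma canonical_mon_supp:
  assumes "supp M \<subseteq> circular_words L" "weight L M \<le> N"
  shows "supp (canonical_mon L M) \<subseteq> basis L N"
proof -
  have "canonical_indices L M ` cycle_slots L M \<subseteq> {1..N}"
    using bij_canonical_indices[of L M] assms(2) by (auto simp: bij_betw_def)
  then show ?thesis
    unfolding canonical_mon_def cycles_mon_def
    using bij_next_slot[OF finite_cycle_indices[of M], of "cycle_words L"] letter_range[OF cycle_words_in[OF assms(1)]]
    by (subst supp_edges_basis) (auto simp: bij_betw_def)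
qed

text \<open>
  The hypothesis concerns a single level, the degree \<open>n\<close>. Compatibility carries it to all higher levels; from
  level \<open>3 n\<close> on it covers every simple monomial, by
  \<open>coefficient_independent_of_indices\<close>, whence \<open>g N = 0\<close>; and zeros propagate
  downwards by projection. A simple monomial given by cycles \<open>C\<close> need not use the chosen representatives, but as
  it occurs in the expansion of the product over \<open>C\<close>, which equals that over the representatives, it is
  also a placement of the latter.
\<close>

lemma P_lim_eq_0I:
  assumes g: "g \<in> P_lim L n"
    and z: "\<And>M. supp M \<subseteq> circular_words L \<Longrightarrow> weight L M = n \<Longrightarrow> lk (g n) (canonical_mon L M) = 0"
  shows "g = 0"
proof -
  have gN: "g N \<in> P_fin 0 L N" "homogeneous n (g N)" "restrict_basis L N (g (Suc N)) = g N" for N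
    using g by (auto simp: P_lim_iff)
  have zN: "lk (g N) (canonical_mon L M) = 0"
    if "n \<le> N" and M: "supp M \<subseteq> circular_words L" "weight L M = n" for N M
    using that(1)
  proof (induction N rule: dec_induct)
    case (step N)
    have "supp (canonical_mon L M) \<subseteq> basis L N" using M step by (intro canonical_mon_supp) auto
    then have "lk (g (Suc N)) (canonical_mon L M) = lk (restrict_basis L N (g (Suc N))) (canonical_mon L M)"
      by (simp add: lookup_restrict_basis)
    then show ?case using step gN(3) by simp
  qed (use z M in simp)
  have big: "g N = 0" if N: "3 * n \<le> N" for N
  proof (rule invariant_eq_0_if_no_simple_monomial[OF gN(1,2)])
    show "n \<le> N" using N by simp
    fix m assume simple: "\<forall>i\<in>{1..N}. rdeg L N m i \<le> 1"
    show "lk (g N) m = 0"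
    proof (rule ccontr)
      assume nz: "lk (g N) m \<noteq> 0"
      have supp: "supp m \<subseteq> basis L N" using P_fin_supp[OF gN(1) nz] .
      obtain C :: "nat list set" and W a where C: "finite C" "W ` C \<subseteq> words L"
        "inj_on a (slots C W)" "a ` slots C W \<subseteq> {1..N}" "cycles_mon C W a = m"
        using simple_balanced_is_cycles_mon[OF supp] invariant_balanced[OF gN(1) nz] simple by blast
      define M where "M = word_type L C W"
      have M: "supp M \<subseteq> circular_words L" using supp_word_type[OF C(2)] by (simp add: M_def)
      let ?J = "cycle_indices M" and ?U = "cycle_words L"
      have "\<exists>a\<in>slots C W \<rightarrow>\<^sub>E {1..N}. cycles_mon C W a = m"
      proof (rule bexI)
        show "cycles_mon C W (restrict a (slots C W)) = m"
          unfolding C(5)[symmetric] cycles_mon_def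
          using bij_betw_apply[OF bij_next_slot[OF C(1), of W]] by (intro edges_cong) auto
        show "restrict a (slots C W) \<in> slots C W \<rightarrow>\<^sub>E {1..N}" using C(4) by auto
      qed
      then have "lk (mono_eval M N) m \<noteq> 0"
        unfolding M_def mono_eval_word_type[OF C(1,2)] lookup_word_trace_nonzero[OF C(1)] .
      then obtain b where b: "b \<in> slots ?J ?U \<rightarrow>\<^sub>E {1..N}" "cycles_mon ?J ?U b = m"
        unfolding mono_eval_eq_word_trace[OF M] lookup_word_trace_nonzero[OF finite_cycle_indices] by blast
      have inj: "inj_on b (slots ?J ?U)"
        using b(2) C(5) by (intro cycles_mon_inj[OF finite_cycle_indices C(1) C(3)]) simp
      have "mon_degree m = n" using gN(2)[of N] nz by (simp add: homogeneous_iff)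
      then have w: "weight L M = n"
        unfolding b(2)[symmetric] by (simp add: cycles_mon_def mon_degree_edges weight_def)
      have "lk (g N) m = lk (g N) (canonical_mon L M)"
        unfolding b(2)[symmetric] canonical_mon_def cycles_mon_def
      proof (rule coefficient_independent_of_indices[OF gN(1)])
        show "bij_betw (next_slot ?U) (slots ?J ?U) (slots ?J ?U)" by (rule bij_next_slot) simp
        show "letter ?U ` slots ?J ?U \<subseteq> {1..L}" by (rule letter_range[OF cycle_words_in[OF M]])
        show "inj_on (canonical_indices L M) (slots ?J ?U)"
          "canonical_indices L M ` slots ?J ?U \<subseteq> {1..N}"
          using bij_canonical_indices[of L M] w N by (auto simp: bij_betw_def)
        show "3 * card (slots ?J ?U) \<le> N" using w N by (simp add: weight_def)
      qed (use inj b in auto)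
      also have "\<dots> = 0" using zN[OF _ M w] N by simp
      finally show False using nz by simp
    qed
  qed
  have "g N = 0" for N
  proof -
    have "g (N + k) = 0 \<Longrightarrow> g N = 0" for k
    proof (induction k)
      case (Suc k)
      have "restrict_basis L (N + k) 0 = 0" by (intro poly_mapping_eqI) (simp add: lookup_restrict_basis)
      then show ?case using Suc gN(3)[of "N + k"] by simp
    qed simp
    then show ?thesis using big[of "N + 3 * n"] by simp
  qed
  then show ?thesis by (simp add: fun_eq_iff)
qed

text \<open>
  The coefficients of \<open>q\<close> are forced by those of \<open>f n\<close> at the canonical placements. Only finitely many types
  matter, since different types have different canonical placements.
\<close>

lemma P_lim_is_eval_circ:
  assumes f: "f \<in> P_lim L n"
  shows "\<exists>q \<in> polys_in (circular_words L). eval_circ q = f"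
proof -
  define S where "S = {M. supp M \<subseteq> circular_words L \<and> weight L M = n \<and> lk (f n) (canonical_mon L M) \<noteq> 0}"
  define z where "z M = lk (f n) (canonical_mon L M) / lk (mono_eval M n) (canonical_mon L M)" for M
  define q where "q = (\<Sum>M\<in>S. Poly_Mapping.single M (z M))"
  have "finite S"
  proof (rule inj_on_finite)
    show "inj_on (canonical_mon L) S" by (auto simp: inj_on_def S_def intro: canonical_mon_inject)
    show "canonical_mon L ` S \<subseteq> supp (f n)" by (auto simp: S_def in_keys_iff)
  qed simp
  then have lq: "lk q M = (if M \<in> S then z M else 0)" for M
    by (simp add: q_def lookup_sum lookup_single when_def sum.delta)
  have q: "q \<in> polys_in (circular_words L)"
    by (auto simp: polys_in_iff lq S_def split: if_splits)
  have "eval_circ q \<in> P_lim L n"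
    unfolding eval_circ_superset[OF finite_keys subset_refl]
  proof (rule P_lim_sum)
    fix M assume "M \<in> supp q"
    then have "M \<in> S" by (auto simp: in_keys_iff lq split: if_splits)
    then show "eval_term (lk q M) M \<in> P_lim L n" using eval_term_P_lim[of M L] by (auto simp: S_def)
  qed
  then have "f - eval_circ q \<in> P_lim L n" by (rule P_lim_diff[OF f])
  then have "f - eval_circ q = 0"
  proof (rule P_lim_eq_0I)
    fix M assume M: "supp M \<subseteq> circular_words L" "weight L M = n"
    have "lk (mono_eval M n) (canonical_mon L M) \<noteq> 0"
      using lookup_mono_eval_canonical_mon[OF M(1) M(1), of n] M(2) by simp
    then have "lk (eval_circ q n) (canonical_mon L M) = lk (f n) (canonical_mon L M)"
      using lookup_eval_circ_canonical_mon[OF q M(1), of n] M by (auto simp: lq z_def S_def)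
    then show "lk ((f - eval_circ q) n) (canonical_mon L M) = 0" by (simp add: lookup_minus)
  qed
  then show ?thesis using q by auto
qed

theorem theorem4p4:
  fixes L :: nat
  assumes "L \<ge> 2"
  shows "freely_generated seq_const (P_lim L) (circular_words L) circ_length p_circ"
  unfolding freely_generated_def bij_betw_def
proof (intro conjI ballI)
  show "p_circ c \<in> P_lim L (circ_length c)" if "c \<in> circular_words L" for c
    using that by (rule p_circ_P_lim)
  show "inj_on eval_circ (polys_in (circular_words L))"
  proof (rule inj_onI)
    fix p q assume pq: "p \<in> polys_in (circular_words L)" "q \<in> polys_in (circular_words L)"
      "eval_circ p = eval_circ q"
    then have "p - q \<in> polys_in (circular_words L)"
      unfolding polys_in_iff lookup_minus by (metis diff_zero)
    then have "p - q = 0" using pq(3) by (intro eval_circ_eq_0) (simp_all add: eval_circ_diff)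
    then show "p = q" by simp
  qed
  show "eval_circ ` polys_in (circular_words L) = graded_sum (P_lim L)"
  proof (intro equalityI subsetI)
    fix f assume "f \<in> graded_sum (P_lim L)"
    then obtain D h where h: "\<forall>n\<le>D. h n \<in> P_lim L n" "f = (\<Sum>n\<le>D. h n)"
      by (auto simp: graded_sum_def)
    then have "\<forall>n\<in>{..D}. \<exists>q. q \<in> polys_in (circular_words L) \<and> eval_circ q = h n"
      using P_lim_is_eval_circ by blast
    then obtain q where q: "\<And>n. n \<le> D \<Longrightarrow> q n \<in> polys_in (circular_words L)" "\<And>n. n \<le> D \<Longrightarrow> eval_circ (q n) = h n"
      by (metis atMost_iff)
    have "(\<Sum>n\<le>D. q n) \<in> polys_in (circular_words L)"
      unfolding polys_in_iff lookup_sum using q(1)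
      by (auto simp: polys_in_iff elim!: sum.not_neutral_contains_not_neutral)
    moreover have "eval_circ (\<Sum>n\<le>D. q n) = f" using q(2) h(2) by (simp add: eval_circ_sum)
    ultimately show "f \<in> eval_circ ` polys_in (circular_words L)" by blast
  qed (auto intro: eval_circ_graded_sum)
qed

end
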